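(* Let $k\ge 1$ and let $\mathcal{P}=\{\{j_1^1,j_1^2\},\ldots,\{j_k^1,j_k^2\}\}$ be any pair partition of the set $[1,2k]=\{1,\ldots,2k\}$. Then the hypergeometric integral $$L(\mathcal{P};H)=\int_{\Delta^{2k}[0,1]}\prod_{l=1}^k|s_{j_l^1}-s_{j_l^2}|^{2H-2}\,ds_1\cdots ds_{2k}$$ has a meromorphic continuation in the variable $H$ to the entire plane $\mathbf{C}$ which is holomorphic in the complement of the union of the rational progressions of the form $$\left\{1-\frac{\left(\sum_{r=1}^s|I_r|\right)+l}{\sum_{r=1}^s\left(|\operatorname{Aug}_{\mathcal{P}}(I_r)|-|\operatorname{Def}_{\mathcal{P}}(I_r)|\right)}\;:\;l=0,1,2,\ldots\right\}\subset\mathbf{Q}$$ with $\{I_1,\ldots,I_s\}$ equal to any collection of pairwise nonadjacent subintervals of $[1,2k]$ such that the denominator is nonzero.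
   Context: A pair partition of $\{1,\ldots,2k\}$ is a partition of this set into $k$ blocks of size two; two elements are paired by $\mathcal{P}$ if they form a block of $\mathcal{P}$. $\Delta^{2k}[0,1]=\{t\in\mathbf{R}^{2k}:0<t_1<\cdots<t_{2k}<1\}$. The integral $L(\mathcal{P};H)$ is initially defined for $\operatorname{Re}H>1/2$; a meromorphic continuation is a meromorphic function on $\mathbf{C}$ agreeing with it there. For natural numbers $a\le b$, $[a,b]=\{a,a+1,\ldots,b\}$; a subinterval of $[1,2k]$ is a set $[a,b]$ with $1\le a\le b\le 2k$. A collection of subintervals $\{I_1,\ldots,I_s\}$ is pairwise nonadjacent if (after ordering from left to right) for $1\le r<\rho\le s$ the right endpoint of $I_r$ is at least two less than the left endpoint of $I_\rho$. For a subinterval $I\subset[1,2k]$: $\operatorname{Aug}_{\mathcal{P}}(I)=I\cup\{p\}$ if the element $p=\min I-1$ immediately left adjacent to $I$ lies in $[1,2k]$ and is paired by $\mathcal{P}$ with an element of $I$; and $\operatorname{Aug}_{\mathcal{P}}(I)=I$ in all other cases. $\operatorname{Def}_{\mathcal{P}}(I)$ is the set of elements of $I$ which are not paired by $\mathcal{P}$ with elements of $\operatorname{Aug}_{\mathcal{P}}(I)$. $|\cdot|$ denotes cardinality. *)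

theory Defs
  imports "HOL-Complex_Analysis.Complex_Analysis" "HOL-Library.Disjoint_Sets"
begin

definition pair_partition :: "nat \<Rightarrow> nat set set \<Rightarrow> bool" where
  "pair_partition k P \<longleftrightarrow>
     partition_on {1..2*k} P \<and> card P = k \<and> (\<forall>B\<in>P. card B = 2)"

definition paired :: "nat set set \<Rightarrow> nat \<Rightarrow> nat \<Rightarrow> bool" where
  "paired P x y \<longleftrightarrow> x \<noteq> y \<and> {x, y} \<in> P"

definition subinterval :: "nat \<Rightarrow> nat set \<Rightarrow> bool" where
  "subinterval k I \<longleftrightarrow> (\<exists>a b. 1 \<le> a \<and> a \<le> b \<and> b \<le> 2*k \<and> I = {a..b})"

text \<open>For two members of a collection of intervals, the disjunct that holds tells which of them
  lies to the left.\<close>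

definition nonadjacent_collection :: "nat \<Rightarrow> nat set set \<Rightarrow> bool" where
  "nonadjacent_collection k C \<longleftrightarrow>
     (\<forall>I\<in>C. subinterval k I) \<and>
     pairwise (\<lambda>I J. Max I + 2 \<le> Min J \<or> Max J + 2 \<le> Min I) C"

text \<open>Truncated subtraction is harmless here: a subinterval has \<open>Min I \<ge> 1\<close>, and for
  \<open>Min I = 1\<close> the value \<open>p = 0\<close> lies outside \<open>{1..2*k}\<close>.\<close>

definition Aug :: "nat \<Rightarrow> nat set set \<Rightarrow> nat set \<Rightarrow> nat set" where
  "Aug k P I =
     (let p = Min I - 1
      in if p \<in> {1..2*k} \<and> (\<exists>q\<in>I. paired P p q) then I \<union> {p} else I)"

definition Def :: "nat \<Rightarrow> nat set set \<Rightarrow> nat set \<Rightarrow> nat set" where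
  "Def k P I = {x \<in> I. \<not> (\<exists>y\<in>Aug k P I. paired P x y)}"

definition denom :: "nat \<Rightarrow> nat set set \<Rightarrow> nat set set \<Rightarrow> int" where
  "denom k P C = (\<Sum>I\<in>C. int (card (Aug k P I)) - int (card (Def k P I)))"

definition progression :: "nat \<Rightarrow> nat set set \<Rightarrow> nat set set \<Rightarrow> rat set" where
  "progression k P C =
     {1 - of_nat ((\<Sum>I\<in>C. card I) + l) / of_int (denom k P C) | l :: nat. True}"

text \<open>Points of \<open>n\<close>-dimensional space are extensional functions on \<open>{1..n}\<close>, the carrier of
  the product measure below, which is Lebesgue measure in dimension \<open>n\<close>.\<close>

definition open_simplex :: "nat \<Rightarrow> (nat \<Rightarrow> real) set" where
  "open_simplex n =
     {t \<in> {1..n} \<rightarrow>\<^sub>E UNIV. 0 < t 1 \<and> (\<forall>i\<in>{1..<n}. t i < t (Suc i)) \<and> t n < 1}"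

abbreviation lebesgue_power :: "nat \<Rightarrow> (nat \<Rightarrow> real) measure" where
  "lebesgue_power n \<equiv> PiM {1..n} (\<lambda>_. lborel)"

text \<open>The blocks are \<open>{j1 l, j2 l}\<close> for \<open>l = 1, \<dots>, k\<close>. On the simplex the bases are positive
  reals, so the complex power is the principal one.\<close>

definition L_integrand ::
    "nat \<Rightarrow> (nat \<Rightarrow> nat) \<Rightarrow> (nat \<Rightarrow> nat) \<Rightarrow> complex \<Rightarrow> (nat \<Rightarrow> real) \<Rightarrow> complex" where
  "L_integrand k j1 j2 H s =
     (\<Prod>l=1..k. complex_of_real \<bar>s (j1 l) - s (j2 l)\<bar> powr (2 * H - 2))"

definition L_integral ::
    "nat \<Rightarrow> (nat \<Rightarrow> nat) \<Rightarrow> (nat \<Rightarrow> nat) \<Rightarrow> complex \<Rightarrow> complex" where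
  "L_integral k j1 j2 H =
     (LINT s:open_simplex (2*k)|lebesgue_power (2*k). L_integrand k j1 j2 H s)"

end

theory Submission
  imports Defs
begin

text \<open>
  In the gap coordinates \<open>x\<^sub>i = s\<^sub>i - s\<^sub>i\<^sub>-\<^sub>1\<close> (with \<open>s\<^sub>0 = 0\<close>) the integral runs over
  \<open>x\<^sub>i > 0\<close>, \<open>\<Sum>x\<^sub>i < 1\<close>, and each block contributes a power of the sum of the gaps between its two
  elements. Split according to the largest gap \<open>x\<^sub>m\<close>, divide the other gaps by it, and repeat with the
  remaining gaps. Every factor then becomes a monomial times a power of \<open>1 + q(x)\<close> with \<open>q \<ge> 0\<close>
  polynomial, and the domain becomes the unit cube. If \<open>S\<close> is the set of gaps still in play when
  \<open>x\<^sub>m\<close> is chosen and \<open>p(S)\<close> counts the blocks whose gaps all lie in \<open>S\<close>, the exponent of \<open>x\<^sub>m\<close>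
  is \<open>|S| - 1 + (2H - 2) p(S)\<close>. Integration by parts continues such a cube integral
  meromorphically, with poles only where \<open>|S| + (2H - 2) p(S)\<close> is a nonpositive integer. The maximal
  intervals of \<open>S\<close> are pairwise nonadjacent, and \<open>|Aug| - |Def|\<close> summed over them is \<open>2 p(S)\<close>, so these
  poles lie in the progressions.
\<close>

section \<open>Changes of variables in coordinate space\<close>

text \<open>On the closed orthant a sum of gaps vanishes exactly where all its gaps vanish, and
  overlapping blocks give zero sets that do not cross normally. Dividing by the largest coordinate
  in play resolves this: a sum containing \<open>x m\<close> leaves a factor with constant term 1,
  which never vanishes on the closed cube, while a sum without \<open>x m\<close> keeps its form
  with fewer coordinates in play. In the exponent of \<open>x m\<close>, the part
  \<open>|S| - 1\<close> is the Jacobian and each block inside \<open>S\<close> adds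
  \<open>2H - 2\<close>. The threshold 1/2 comes from \<open>p(S) <= |S|\<close>: blocks inside
  \<open>S\<close> have distinct right ends, and each right end is the number of a gap in
  \<open>S\<close>. The one-sided shape of \<open>Aug\<close> comes from the numbering of gaps: gap
  \<open>i\<close> joins the points \<open>i - 1\<close> and \<open>i\<close>, so a block has all
  its gaps in \<open>[a,b]\<close> exactly when both its elements lie in \<open>[a-1,b]\<close>. The
  bound on the poles uses only which exponents can occur, for all nonempty \<open>S\<close> at once,
  so the order in which the coordinates are blown up never has to be recorded in the result.\<close>

abbreviation lebesgue_on_coords :: "nat set \<Rightarrow> (nat \<Rightarrow> real) measure" where
  "lebesgue_on_coords N \<equiv> PiM N (\<lambda>_. lborel)"

text \<open>Encoded as a pushforward identity: integrating \<open>f\<close> equals integrating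
  \<open>J\<close> times \<open>f\<close> composed with \<open>\<psi>\<close>. This form composes
  directly and can be checked by Tonelli, one coordinate at a time.\<close>

definition change_of_variables :: "'a measure \<Rightarrow> ('a \<Rightarrow> 'a) \<Rightarrow> ('a \<Rightarrow> real) \<Rightarrow> bool" where
  "change_of_variables M \<psi> J \<longleftrightarrow>
     \<psi> \<in> M \<rightarrow>\<^sub>M M \<and> J \<in> borel_measurable M \<and> (\<forall>x\<in>space M. 0 \<le> J x) \<and>
     distr (density M J) M \<psi> = M"

lemma change_of_variables_integral:
  fixes f :: "'a \<Rightarrow> complex"
  assumes cov: "change_of_variables M \<psi> J" and f: "f \<in> borel_measurable M"
  shows "integrable M f \<longleftrightarrow> integrable M (\<lambda>x. J x *\<^sub>R f (\<psi> x))"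
    and "integral\<^sup>L M f = integral\<^sup>L M (\<lambda>x. J x *\<^sub>R f (\<psi> x))"
proof -
  have \<psi>: "\<psi> \<in> M \<rightarrow>\<^sub>M M" and J: "J \<in> borel_measurable M" and J0: "AE x in M. 0 \<le> J x"
    and D: "distr (density M J) M \<psi> = M"
    using cov by (auto simp: change_of_variables_def)
  have \<psi>': "\<psi> \<in> density M J \<rightarrow>\<^sub>M M" using \<psi> by simp
  have f\<psi>: "(\<lambda>x. f (\<psi> x)) \<in> borel_measurable M" using \<psi> f by measurable
  have "integrable M f \<longleftrightarrow> integrable (distr (density M J) M \<psi>) f" by (simp add: D)
  also have "\<dots> \<longleftrightarrow> integrable (density M J) (\<lambda>x. f (\<psi> x))"
    using \<psi>' f by (rule integrable_distr_eq)
  also have "\<dots> \<longleftrightarrow> integrable M (\<lambda>x. J x *\<^sub>R f (\<psi> x))"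
    using f\<psi> J J0 by (rule integrable_density)
  finally show "integrable M f \<longleftrightarrow> integrable M (\<lambda>x. J x *\<^sub>R f (\<psi> x))" .
  have "integral\<^sup>L M f = integral\<^sup>L (distr (density M J) M \<psi>) f" by (simp add: D)
  also have "\<dots> = integral\<^sup>L (density M J) (\<lambda>x. f (\<psi> x))"
    using \<psi>' f by (rule integral_distr)
  also have "\<dots> = integral\<^sup>L M (\<lambda>x. J x *\<^sub>R f (\<psi> x))"
    using f\<psi> J J0 by (rule integral_density)
  finally show "integral\<^sup>L M f = integral\<^sup>L M (\<lambda>x. J x *\<^sub>R f (\<psi> x))" .
qed

text \<open>For nonnegative functions no integrability question arises, so compositions and iterated
  integrals can be handled freely in this form.\<close>

lemma change_of_variables_iff_nn_integral:
  assumes "\<psi> \<in> M \<rightarrow>\<^sub>M M" "J \<in> borel_measurable M" "\<And>x. x \<in> space M \<Longrightarrow> 0 \<le> J x"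
  shows "change_of_variables M \<psi> J \<longleftrightarrow>
    (\<forall>f\<in>borel_measurable M. (\<integral>\<^sup>+x. f x \<partial>M) = (\<integral>\<^sup>+x. ennreal (J x) * f (\<psi> x) \<partial>M))"
    (is "_ \<longleftrightarrow> ?R")
proof -
  have *: "(\<integral>\<^sup>+x. f x \<partial>distr (density M J) M \<psi>) = (\<integral>\<^sup>+x. ennreal (J x) * f (\<psi> x) \<partial>M)"
    if [measurable]: "f \<in> borel_measurable M" for f
  proof -
    note [measurable] = assms(1,2)
    have "(\<integral>\<^sup>+x. f x \<partial>distr (density M J) M \<psi>) = (\<integral>\<^sup>+x. f (\<psi> x) \<partial>density M J)"
      by (rule nn_integral_distr) simp_all
    also have "\<dots> = (\<integral>\<^sup>+x. ennreal (J x) * f (\<psi> x) \<partial>M)"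
      by (rule nn_integral_density) simp_all
    finally show ?thesis .
  qed
  show ?thesis
  proof
    assume "change_of_variables M \<psi> J"
    then have "distr (density M J) M \<psi> = M" by (simp add: change_of_variables_def)
    then show ?R using * by metis
  next
    assume R: ?R
    have "distr (density M J) M \<psi> = M"
    proof (rule measure_eqI)
      fix A assume A: "A \<in> sets (distr (density M J) M \<psi>)"
      then have "emeasure (distr (density M J) M \<psi>) A
          = (\<integral>\<^sup>+x. indicator A x \<partial>distr (density M J) M \<psi>)" by (simp add: nn_integral_indicator)
      also have "\<dots> = (\<integral>\<^sup>+x. ennreal (J x) * indicator A (\<psi> x) \<partial>M)"
        using A by (subst *) simp_all
      also have "\<dots> = (\<integral>\<^sup>+x. indicator A x \<partial>M)"
        by (rule R[rule_format, symmetric]) (use A in simp)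
      finally show "emeasure (distr (density M J) M \<psi>) A = emeasure M A" using A by simp
    qed simp
    then show "change_of_variables M \<psi> J"
      using assms by (auto simp: change_of_variables_def)
  qed
qed

lemma change_of_variables_compose:
  assumes 1: "change_of_variables M \<psi> J" and 2: "change_of_variables M \<phi> K"
  shows "change_of_variables M (\<lambda>x. \<psi> (\<phi> x)) (\<lambda>x. K x * J (\<phi> x))"
proof -
  have m[measurable]: "\<psi> \<in> M \<rightarrow>\<^sub>M M" "J \<in> borel_measurable M" "\<phi> \<in> M \<rightarrow>\<^sub>M M" "K \<in> borel_measurable M"
    and J0: "\<And>x. x \<in> space M \<Longrightarrow> 0 \<le> J x" and K0: "\<And>x. x \<in> space M \<Longrightarrow> 0 \<le> K x"
    using 1 2 by (auto simp: change_of_variables_def)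
  have sp: "\<And>x. x \<in> space M \<Longrightarrow> \<phi> x \<in> space M" using m(3) by (rule measurable_space)
  have R1: "(\<integral>\<^sup>+x. f x \<partial>M) = (\<integral>\<^sup>+x. ennreal (J x) * f (\<psi> x) \<partial>M)" if "f \<in> borel_measurable M" for f
    using iffD1[OF change_of_variables_iff_nn_integral[OF m(1,2) J0] 1] that by blast
  have R2: "(\<integral>\<^sup>+x. f x \<partial>M) = (\<integral>\<^sup>+x. ennreal (K x) * f (\<phi> x) \<partial>M)" if "f \<in> borel_measurable M" for f
    using iffD1[OF change_of_variables_iff_nn_integral[OF m(3,4) K0] 2] that by blast
  show ?thesis
  proof (subst change_of_variables_iff_nn_integral, safe)
    fix f :: "'a \<Rightarrow> ennreal" assume [measurable]: "f \<in> borel_measurable M"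
    have "(\<integral>\<^sup>+x. f x \<partial>M) = (\<integral>\<^sup>+x. ennreal (J x) * f (\<psi> x) \<partial>M)" by (rule R1) simp
    also have "\<dots> = (\<integral>\<^sup>+x. ennreal (K x) * (ennreal (J (\<phi> x)) * f (\<psi> (\<phi> x))) \<partial>M)"
      by (rule R2) simp
    also have "\<dots> = (\<integral>\<^sup>+x. ennreal (K x * J (\<phi> x)) * f (\<psi> (\<phi> x)) \<partial>M)"
      by (intro nn_integral_cong) (simp add: ennreal_mult K0 J0 sp mult.assoc)
    finally show "(\<integral>\<^sup>+x. f x \<partial>M) = (\<integral>\<^sup>+x. ennreal (K x * J (\<phi> x)) * f (\<psi> (\<phi> x)) \<partial>M)" .
  qed (auto simp: K0 J0 sp)
qed

lemma measurable_update_coord: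
  assumes "i \<in> N" "g \<in> borel_measurable (lebesgue_on_coords N)"
  shows "(\<lambda>x. x(i := g x)) \<in> lebesgue_on_coords N \<rightarrow>\<^sub>M lebesgue_on_coords N"
proof -
  have "(\<lambda>x j. if j = i then g x else x j) \<in> lebesgue_on_coords N \<rightarrow>\<^sub>M lebesgue_on_coords N"
  proof (rule measurable_PiM_single')
    show "(\<lambda>x. if j = i then g x else x j) \<in> lebesgue_on_coords N \<rightarrow>\<^sub>M lborel" if "j \<in> N" for j
      using assms that by (cases "j = i") auto
    show "(\<lambda>x j. if j = i then g x else x j) \<in> space (lebesgue_on_coords N) \<rightarrow> (\<Pi>\<^sub>E j\<in>N. space lborel)"
      using assms(1) by (auto simp: space_PiM PiE_def extensional_def)
  qed
  then show ?thesis by (simp add: fun_upd_def)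
qed

text \<open>The elementary step from which every substitution below is composed. With the other
  coordinates fixed, \<open>a\<close> and \<open>c\<close> are constants, so Tonelli reduces the
  claim to the affine rule for Lebesgue measure on the line.\<close>

lemma change_of_variables_affine:
  assumes N: "finite N" "i \<in> N"
    and a[measurable]: "a \<in> borel_measurable (lebesgue_on_coords N)"
    and c[measurable]: "c \<in> borel_measurable (lebesgue_on_coords N)"
    and c0: "\<And>x. 0 < c x"
    and inda: "\<And>x y. a (x(i := y)) = a x" and indc: "\<And>x y. c (x(i := y)) = c x"
  shows "change_of_variables (lebesgue_on_coords N) (\<lambda>x. x(i := a x + c x * x i)) c"
proof -
  interpret product_sigma_finite "\<lambda>_::nat. lborel :: real measure" ..
  let ?M = "lebesgue_on_coords N" and ?\<psi> = "\<lambda>x. x(i := a x + c x * x i)"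
  have xi[measurable]: "(\<lambda>x. x i) \<in> borel_measurable ?M"
    using measurable_component_singleton[OF N(2), of "\<lambda>_. lborel::real measure"] by simp
  have \<psi>[measurable]: "?\<psi> \<in> ?M \<rightarrow>\<^sub>M ?M"
    by (rule measurable_update_coord[OF N(2)]) simp
  obtain N' where N': "N = insert i N'" "i \<notin> N'" using N by (meson mk_disjoint_insert)
  have fin: "finite N'" using N N' by simp
  show ?thesis
  proof (subst change_of_variables_iff_nn_integral, safe)
    fix f :: "(nat \<Rightarrow> real) \<Rightarrow> ennreal" assume f[measurable]: "f \<in> borel_measurable ?M"
    have "(\<integral>\<^sup>+x. f x \<partial>?M) = (\<integral>\<^sup>+x. (\<integral>\<^sup>+y. f (x(i := y)) \<partial>lborel) \<partial>lebesgue_on_coords N')"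
      using f unfolding N'(1) by (rule product_nn_integral_insert[OF fin N'(2)])
    also have "\<dots> = (\<integral>\<^sup>+x. (\<integral>\<^sup>+y. ennreal (c x) * f (x(i := a x + c x * y)) \<partial>lborel) \<partial>lebesgue_on_coords N')"
    proof (rule nn_integral_cong)
      fix x assume x: "x \<in> space (lebesgue_on_coords N')"
      have "(\<lambda>y. x(i := y)) \<in> lborel \<rightarrow>\<^sub>M ?M"
        unfolding N'(1) using x by (intro measurable_fun_upd[where J = N'] measurable_const) auto
      then have fm[measurable]: "(\<lambda>y. f (x(i := y))) \<in> borel_measurable lborel" using f by measurable
      have "(\<integral>\<^sup>+y. f (x(i := y)) \<partial>lborel) = \<bar>c x\<bar> * (\<integral>\<^sup>+y. f (x(i := a x + c x * y)) \<partial>lborel)"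
        by (rule nn_integral_real_affine) (use fm c0[of x] in auto)
      also have "\<dots> = (\<integral>\<^sup>+y. ennreal (c x) * f (x(i := a x + c x * y)) \<partial>lborel)"
        using c0[of x] by (subst nn_integral_cmult) auto
      finally show "(\<integral>\<^sup>+y. f (x(i := y)) \<partial>lborel)
        = (\<integral>\<^sup>+y. ennreal (c x) * f (x(i := a x + c x * y)) \<partial>lborel)" .
    qed
    also have "\<dots> = (\<integral>\<^sup>+x. (\<integral>\<^sup>+y. ennreal (c (x(i := y))) * f (?\<psi> (x(i := y))) \<partial>lborel) \<partial>lebesgue_on_coords N')"
      by (simp add: inda indc)
    also have "\<dots> = (\<integral>\<^sup>+x. ennreal (c x) * f (?\<psi> x) \<partial>?M)"
      unfolding N'(1)
    proof (rule product_nn_integral_insert[OF fin N'(2), symmetric])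
      show "(\<lambda>x. ennreal (c x) * f (?\<psi> x)) \<in> borel_measurable (lebesgue_on_coords (insert i N'))"
        unfolding N'(1)[symmetric] by simp
    qed
    finally show "(\<integral>\<^sup>+x. f x \<partial>?M) = (\<integral>\<^sup>+x. ennreal (c x) * f (?\<psi> x) \<partial>?M)" .
  qed (auto intro: less_imp_le[OF c0])
qed

lemma measurable_coord [measurable (raw)]:
  "i \<in> N \<Longrightarrow> (\<lambda>x. x i) \<in> borel_measurable (lebesgue_on_coords N)"
  using measurable_component_singleton[of i N "\<lambda>_. lborel::real measure"] by simp

lemma change_of_variables_id: "change_of_variables M (\<lambda>x. x) (\<lambda>_. 1)"
  by (subst change_of_variables_iff_nn_integral) auto

text \<open>Only \<open>x m > 0\<close> matters; the other branch keeps the Jacobian positive on the whole space.\<close>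

definition coord_scale :: "nat set \<Rightarrow> nat \<Rightarrow> (nat \<Rightarrow> real) \<Rightarrow> nat \<Rightarrow> real" where
  "coord_scale A m x = (\<lambda>i. if i \<in> A then (if 0 < x m then x m else 1) * x i else x i)"

text \<open>The coordinates in \<open>A\<close> are scaled one after the other. The factor depends
  only on \<open>x m\<close>, which never changes because \<open>m\<close> is outside
  \<open>A\<close>, so each of the \<open>card A\<close> steps contributes the same
  Jacobian.\<close>

lemma change_of_variables_coord_scale:
  assumes "finite N" "A \<subseteq> N" "m \<in> N" "m \<notin> A"
  shows "change_of_variables (lebesgue_on_coords N) (coord_scale A m)
           (\<lambda>x. (if 0 < x m then x m else 1) ^ card A)"
proof -
  have "finite A" using assms finite_subset by blast
  then show ?thesis using assms(2,4)
  proof (induction A)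
    case empty
    have "coord_scale {} m = (\<lambda>x. x)" by (simp add: coord_scale_def fun_eq_iff)
    then show ?case using change_of_variables_id by simp
  next
    case (insert i A)
    let ?M = "lebesgue_on_coords N" and ?p = "\<lambda>x::nat \<Rightarrow> real. if 0 < x m then x m else 1"
    have xm: "(\<lambda>x. x m) \<in> borel_measurable ?M" using assms(3) by (rule measurable_coord)
    have [measurable]: "?p \<in> borel_measurable ?M" using xm by measurable
    have 1: "change_of_variables ?M (\<lambda>x. x(i := 0 + ?p x * x i)) ?p"
      by (rule change_of_variables_affine) (use assms insert.prems in auto)
    have 2: "change_of_variables ?M (coord_scale A m) (\<lambda>x. ?p x ^ card A)"
      using insert by simp
    have m: "coord_scale A m x m = x m" "coord_scale A m x i = x i" for x
      using insert by (auto simp: coord_scale_def)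
    have e: "(coord_scale A m x)(i := 0 + ?p (coord_scale A m x) * coord_scale A m x i)
        = coord_scale (insert i A) m x" for x
      unfolding m using insert.hyps by (auto simp: coord_scale_def fun_eq_iff)
    have "?p x ^ card A * ?p (coord_scale A m x) = ?p x ^ card (insert i A)" for x
      unfolding m using insert.hyps by (simp add: mult.commute)
    then show ?case using change_of_variables_compose[OF 1 2] unfolding e by simp
  qed
qed

section \<open>Splitting space according to the largest coordinate\<close>

lemma AE_coords_distinct:
  assumes "finite N"
  shows "AE x in lebesgue_on_coords N. \<forall>i\<in>N. \<forall>j\<in>N. i \<noteq> j \<longrightarrow> x i \<noteq> x j"
proof -
  interpret product_sigma_finite "\<lambda>_::nat. lborel :: real measure" ..
  let ?M = "lebesgue_on_coords N"
  have "AE x in ?M. x i \<noteq> x j" if ij: "i \<in> N" "j \<in> N" "i \<noteq> j" for i j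
  proof -
    obtain N' where N': "N = insert i N'" "i \<notin> N'" using ij by (meson mk_disjoint_insert)
    have fin: "finite N'" using assms N' by simp
    let ?S = "{x \<in> space ?M. x i = x j}"
    have [measurable]: "(\<lambda>x. x i) \<in> borel_measurable ?M" "(\<lambda>x. x j) \<in> borel_measurable ?M"
      using ij by (auto intro: measurable_coord)
    have S: "?S \<in> sets ?M" by measurable
    have "emeasure ?M ?S = (\<integral>\<^sup>+x. indicator ?S x \<partial>?M)" using S by simp
    also have "\<dots> = (\<integral>\<^sup>+x. (\<integral>\<^sup>+y. indicator ?S (x(i := y)) \<partial>lborel) \<partial>lebesgue_on_coords N')"
      using S unfolding N'(1) by (intro product_nn_integral_insert[OF fin N'(2)]) simp
    also have "\<dots> = (\<integral>\<^sup>+x. 0 \<partial>lebesgue_on_coords N')"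
    proof (rule nn_integral_cong)
      \<comment> \<open>With all coordinates but \<open>i\<close> fixed, the tie set is contained in
        the single point \<open>x j\<close>, a null set of the line.\<close>
      fix x :: "nat \<Rightarrow> real"
      have "(\<integral>\<^sup>+y. indicator ?S (x(i := y)) \<partial>lborel) \<le> (\<integral>\<^sup>+y. indicator {x j} y \<partial>lborel)"
        using ij(3) by (intro nn_integral_mono) (auto simp: indicator_def)
      also have "\<dots> = 0" by simp
      finally show "(\<integral>\<^sup>+y. indicator ?S (x(i := y)) \<partial>lborel) = 0" by simp
    qed
    finally have "emeasure ?M ?S = 0" by simp
    then show ?thesis using S by (intro AE_I[of _ _ ?S]) auto
  qed
  then show ?thesis using assms by (intro AE_finite_allI) auto
qed

text \<open>Strict inequalities make the sets for different \<open>m\<close> disjoint; the ties they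
  leave out form a null set.\<close>

definition dominant :: "nat set \<Rightarrow> nat \<Rightarrow> (nat \<Rightarrow> real) set" where
  "dominant T m = {x. \<forall>i\<in>T - {m}. x i < x m}"

lemma measurable_indicator_dominant:
  assumes "finite N" "T \<subseteq> N" "m \<in> T"
  shows "indicat_real (dominant T m) \<in> borel_measurable (lebesgue_on_coords N)"
proof -
  have "finite T" using assms finite_subset by blast
  have "(\<lambda>x. x i) \<in> borel_measurable (lebesgue_on_coords N)" if "i \<in> T" for i
    using that assms by (intro measurable_coord) auto
  then have "{x \<in> space (lebesgue_on_coords N). \<forall>i\<in>T - {m}. x i < x m} \<in> sets (lebesgue_on_coords N)"
    using \<open>finite T\<close> \<open>m \<in> T\<close> by (intro sets.sets_Collect_finite_All borel_measurable_less) auto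
  moreover have "indicat_real (dominant T m) x
      = indicat_real {x \<in> space (lebesgue_on_coords N). \<forall>i\<in>T - {m}. x i < x m} x"
    if "x \<in> space (lebesgue_on_coords N)" for x
    using that by (auto simp: dominant_def indicator_def)
  ultimately show ?thesis by (subst measurable_cong) auto
qed

lemma sum_indicator_dominant:
  assumes "finite T" "T \<noteq> {}" "\<And>i j. i \<in> T \<Longrightarrow> j \<in> T \<Longrightarrow> i \<noteq> j \<Longrightarrow> x i \<noteq> (x j :: real)"
  shows "(\<Sum>m\<in>T. indicat_real (dominant T m) x) = 1"
proof -
  have "Max (x ` T) \<in> x ` T" using assms by (intro Max_in) auto
  then obtain m where m: "m \<in> T" "x m = Max (x ` T)" by (metis imageE)
  have le: "x i \<le> x m" if "i \<in> T" for i using m(2) that assms(1) by simp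
  have lt: "x i < x m" if "i \<in> T" "i \<noteq> m" for i
    using le[OF that(1)] assms(3)[OF that(1) m(1) that(2)] by simp
  have "(\<Sum>j\<in>T. indicat_real (dominant T j) x) = (\<Sum>j\<in>T. if j = m then 1 else 0)"
  proof (rule sum.cong[OF refl])
    fix j assume "j \<in> T"
    then show "indicat_real (dominant T j) x = (if j = m then 1 else 0)"
    proof (cases "j = m")
      case True then show ?thesis using lt by (simp add: dominant_def)
    next
      case False
      then have "\<not> x m < x j" using lt[OF \<open>j \<in> T\<close>] by simp
      then show ?thesis using False m(1) by (auto simp: dominant_def indicator_def)
    qed
  qed
  then show ?thesis using m assms by simp
qed

text \<open>Each piece is pulled back by its own substitution. Integrability of \<open>f\<close> is
  a conclusion, drawn from the transformed pieces, because in the sector decomposition only the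
  fully resolved integrals are known to converge beforehand.\<close>

lemma integral_split_dominant:
  fixes f :: "(nat \<Rightarrow> real) \<Rightarrow> complex"
  assumes N: "finite N" "T \<subseteq> N" "T \<noteq> {}"
    and f[measurable]: "f \<in> borel_measurable (lebesgue_on_coords N)"
    and cov: "\<And>m. m \<in> T \<Longrightarrow> change_of_variables (lebesgue_on_coords N) (\<psi> m) (J m)"
    and int: "\<And>m. m \<in> T \<Longrightarrow> integrable (lebesgue_on_coords N)
        (\<lambda>x. J m x *\<^sub>R indicat_real (dominant T m) (\<psi> m x) *\<^sub>R f (\<psi> m x))"
  shows "integrable (lebesgue_on_coords N) f"
    and "(\<integral>x. f x \<partial>lebesgue_on_coords N) = (\<Sum>m\<in>T. \<integral>x. J m x *\<^sub>R
        indicat_real (dominant T m) (\<psi> m x) *\<^sub>R f (\<psi> m x) \<partial>lebesgue_on_coords N)"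
proof -
  let ?M = "lebesgue_on_coords N"
  let ?g = "\<lambda>m x. indicat_real (dominant T m) x *\<^sub>R f x"
  have T: "finite T" using N finite_subset by blast
  have gm: "?g m \<in> borel_measurable ?M" if "m \<in> T" for m
    using measurable_indicator_dominant[OF N(1,2) that] f by (intro borel_measurable_scaleR)
  have gi: "integrable ?M (?g m)" if "m \<in> T" for m
    using int[OF that] change_of_variables_integral(1)[OF cov[OF that] gm[OF that]] by simp
  have ae: "AE x in ?M. f x = (\<Sum>m\<in>T. ?g m x)"
    using AE_coords_distinct[OF N(1)]
  proof eventually_elim
    case (elim x)
    then have "(\<Sum>m\<in>T. indicat_real (dominant T m) x) = 1"
      using N T by (intro sum_indicator_dominant) auto
    then show ?case by (simp flip: scaleR_left.sum)
  qed
  have sumi: "integrable ?M (\<lambda>x. \<Sum>m\<in>T. ?g m x)" using gi by (rule Bochner_Integration.integrable_sum)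
  have sm: "(\<lambda>x. \<Sum>m\<in>T. ?g m x) \<in> borel_measurable ?M" using sumi by (rule borel_measurable_integrable)
  show "integrable ?M f"
    using integrable_cong_AE[OF f sm ae] sumi by simp
  have "(\<integral>x. f x \<partial>?M) = (\<integral>x. (\<Sum>m\<in>T. ?g m x) \<partial>?M)" by (rule integral_cong_AE[OF f sm ae])
  also have "\<dots> = (\<Sum>m\<in>T. \<integral>x. ?g m x \<partial>?M)" using gi by (rule Bochner_Integration.integral_sum)
  also have "\<dots> = (\<Sum>m\<in>T. \<integral>x. J m x *\<^sub>R
        indicat_real (dominant T m) (\<psi> m x) *\<^sub>R f (\<psi> m x) \<partial>?M)"
    by (intro sum.cong refl change_of_variables_integral(2) cov gm)
  finally show "(\<integral>x. f x \<partial>?M) = (\<Sum>m\<in>T. \<integral>x. J m x *\<^sub>R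
        indicat_real (dominant T m) (\<psi> m x) *\<^sub>R f (\<psi> m x) \<partial>?M)" .
qed

section \<open>Amplitudes\<close>

text \<open>Coefficients are nonnegative so that \<open>1 + q\<close> is at least 1 on the closed
  positive orthant, where its complex powers stay away from the branch cut and from the base
  0.\<close>

inductive coord_poly :: "nat set \<Rightarrow> ((nat \<Rightarrow> real) \<Rightarrow> real) \<Rightarrow> bool" for N where
  coord_poly_const: "0 \<le> c \<Longrightarrow> coord_poly N (\<lambda>_. c)"
| coord_poly_coord: "i \<in> N \<Longrightarrow> coord_poly N (\<lambda>x. x i)"
| coord_poly_add: "coord_poly N p \<Longrightarrow> coord_poly N q \<Longrightarrow> coord_poly N (\<lambda>x. p x + q x)"
| coord_poly_mult: "coord_poly N p \<Longrightarrow> coord_poly N q \<Longrightarrow> coord_poly N (\<lambda>x. p x * q x)"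

text \<open>Smooth on the closed positive orthant, entire in \<open>H\<close>, and closed under partial derivatives and
  polynomial substitutions: this closure is what lets integration by parts be iterated.\<close>

inductive amplitude :: "nat set \<Rightarrow> ((nat \<Rightarrow> real) \<Rightarrow> complex \<Rightarrow> complex) \<Rightarrow> bool" for N where
  amplitude_entire: "h holomorphic_on UNIV \<Longrightarrow> amplitude N (\<lambda>_. h)"
| amplitude_poly: "coord_poly N q \<Longrightarrow> amplitude N (\<lambda>x _. complex_of_real (q x))"
| amplitude_powr: "coord_poly N q \<Longrightarrow> amplitude N (\<lambda>x H. complex_of_real (1 + q x) powr (a + b * H))"
| amplitude_add: "amplitude N \<Phi> \<Longrightarrow> amplitude N \<Psi> \<Longrightarrow> amplitude N (\<lambda>x H. \<Phi> x H + \<Psi> x H)"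
| amplitude_mult: "amplitude N \<Phi> \<Longrightarrow> amplitude N \<Psi> \<Longrightarrow> amplitude N (\<lambda>x H. \<Phi> x H * \<Psi> x H)"

lemma coord_poly_nonneg: "coord_poly N q \<Longrightarrow> \<forall>i\<in>N. 0 \<le> x i \<Longrightarrow> 0 \<le> q x"
  by (induction rule: coord_poly.induct) auto

lemma coord_poly_measurable: "coord_poly N q \<Longrightarrow> q \<in> borel_measurable (lebesgue_on_coords N)"
  by (induction rule: coord_poly.induct) (auto intro: measurable_coord)

lemma coord_poly_bounded:
  "coord_poly N q \<Longrightarrow> \<exists>B. \<forall>x. (\<forall>i\<in>N. 0 \<le> x i \<and> x i \<le> 1) \<longrightarrow> q x \<le> B"
proof (induction rule: coord_poly.induct)
  case (coord_poly_add p q)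
  then show ?case by (meson add_mono)
next
  case (coord_poly_mult p q)
  then obtain B C where "\<And>x. (\<forall>i\<in>N. 0 \<le> x i \<and> x i \<le> 1) \<Longrightarrow> p x \<le> B"
    "\<And>x. (\<forall>i\<in>N. 0 \<le> x i \<and> x i \<le> 1) \<Longrightarrow> q x \<le> C" by blast
  then have "p x * q x \<le> B * C" if "\<forall>i\<in>N. 0 \<le> x i \<and> x i \<le> 1" for x
    using that coord_poly_nonneg[OF coord_poly_mult.hyps(1)] coord_poly_nonneg[OF coord_poly_mult.hyps(2)]
    by (intro mult_mono) (meson order_trans | blast)+
  then show ?case by blast
qed auto

lemma coord_poly_subst:
  assumes "coord_poly N q" "\<And>i. i \<in> N \<Longrightarrow> coord_poly N (\<lambda>x. \<psi> x i)"
  shows "coord_poly N (\<lambda>x. q (\<psi> x))"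
  using assms by (induction rule: coord_poly.induct) (auto intro: coord_poly.intros)

lemma coord_poly_sum:
  "finite A \<Longrightarrow> (\<And>i. i \<in> A \<Longrightarrow> coord_poly N (f i)) \<Longrightarrow> coord_poly N (\<lambda>x. \<Sum>i\<in>A. f i x)"
  by (induction A rule: finite_induct) (auto intro: coord_poly.intros)

text \<open>Differentiation multiplies coefficients by natural numbers only, so it does not leave
  the nonnegative class.\<close>

lemma coord_poly_derivative:
  "coord_poly N q \<Longrightarrow> \<exists>q'. coord_poly N q' \<and>
     (\<forall>x. ((\<lambda>t. q (x(j := t))) has_real_derivative q' x) (at (x j)))"
proof (induction rule: coord_poly.induct)
  case (coord_poly_const c)
  show ?case by (rule exI[of _ "\<lambda>_. 0"]) (auto intro: coord_poly.intros)
next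
  case (coord_poly_coord i)
  show ?case
    by (rule exI[of _ "\<lambda>_. if i = j then 1 else 0"])
      (cases "i = j"; auto intro!: coord_poly.intros DERIV_ident)
next
  case (coord_poly_add p q)
  then obtain p' q' where *: "coord_poly N p'" "coord_poly N q'"
    "\<And>x. ((\<lambda>t. p (x(j := t))) has_real_derivative p' x) (at (x j))"
    "\<And>x. ((\<lambda>t. q (x(j := t))) has_real_derivative q' x) (at (x j))" by blast
  have "((\<lambda>t. p (x(j := t)) + q (x(j := t))) has_real_derivative (p' x + q' x)) (at (x j))" for x
    by (rule DERIV_add[OF *(3,4)])
  then show ?case using coord_poly.coord_poly_add[OF *(1,2)] by blast
next
  case (coord_poly_mult p q)
  then obtain p' q' where *: "coord_poly N p'" "coord_poly N q'"
    "\<And>x. ((\<lambda>t. p (x(j := t))) has_real_derivative p' x) (at (x j))"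
    "\<And>x. ((\<lambda>t. q (x(j := t))) has_real_derivative q' x) (at (x j))" by blast
  have "((\<lambda>t. p (x(j := t)) * q (x(j := t))) has_real_derivative (p' x * q x + q' x * p x)) (at (x j))" for x
    using DERIV_mult[OF *(3)[of x] *(4)[of x]] by simp
  moreover have "coord_poly N (\<lambda>x. p' x * q x + q' x * p x)"
    by (intro coord_poly.intros * coord_poly_mult.hyps)
  ultimately show ?case by blast
qed

lemma amplitude_subst:
  assumes "amplitude N \<Phi>" "\<And>i. i \<in> N \<Longrightarrow> coord_poly N (\<lambda>x. \<psi> x i)"
  shows "amplitude N (\<lambda>x H. \<Phi> (\<psi> x) H)"
  using assms(1)
proof (induction rule: amplitude.induct)
  case (amplitude_poly q)
  show ?case by (rule amplitude.amplitude_poly[OF coord_poly_subst[OF amplitude_poly assms(2)]])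
next
  case (amplitude_powr q a b)
  show ?case by (rule amplitude.amplitude_powr[OF coord_poly_subst[OF amplitude_powr assms(2)]])
qed (auto intro: amplitude.intros)

lemma amplitude_prod:
  "finite A \<Longrightarrow> (\<And>i. i \<in> A \<Longrightarrow> amplitude N (f i)) \<Longrightarrow> amplitude N (\<lambda>x H. \<Prod>i\<in>A. f i x H)"
proof (induction A rule: finite_induct)
  case empty
  have "amplitude N (\<lambda>x H. 1)" by (rule amplitude_entire) simp
  then show ?case by simp
qed (auto intro: amplitude.intros)

lemma amplitude_measurable:
  "amplitude N \<Phi> \<Longrightarrow> (\<lambda>x. \<Phi> x H) \<in> borel_measurable (lebesgue_on_coords N)"
proof (induction rule: amplitude.induct)
  case (amplitude_powr q a b)
  note [measurable] = coord_poly_measurable[OF this]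
  show ?case unfolding powr_def by measurable
next
  case (amplitude_poly q)
  note [measurable] = coord_poly_measurable[OF this]
  show ?case by measurable
qed auto

lemma amplitude_holomorphic:
  "amplitude N \<Phi> \<Longrightarrow> \<forall>i\<in>N. 0 \<le> x i \<Longrightarrow> \<Phi> x holomorphic_on UNIV"
proof (induction rule: amplitude.induct)
  case (amplitude_powr q a b)
  then have "1 + q x \<noteq> 0" using coord_poly_nonneg[of N q x] by linarith
  then have "complex_of_real (1 + q x) \<noteq> 0" by (metis of_real_eq_0_iff)
  then have "(\<lambda>H. complex_of_real (1 + q x) powr (a + b * H))
      = (\<lambda>H. exp ((a + b * H) * Ln (complex_of_real (1 + q x))))"
    by (simp add: powr_def)
  then show ?case by (auto intro!: holomorphic_intros)
qed (auto intro!: holomorphic_intros)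

text \<open>The bound is uniform in \<open>x\<close> on the closed cube and in \<open>H\<close> on a
  disk; it lets a single integrable function dominate the integrands for all nearby
  \<open>H\<close>.\<close>

lemma amplitude_bounded:
  "amplitude N \<Phi> \<Longrightarrow>
     \<exists>B. \<forall>x H. (\<forall>i\<in>N. 0 \<le> x i \<and> x i \<le> 1) \<longrightarrow> norm H \<le> R \<longrightarrow> norm (\<Phi> x H) \<le> B"
proof (induction rule: amplitude.induct)
  case (amplitude_entire h)
  have "compact (h ` cball 0 R)"
    using amplitude_entire
    by (intro compact_continuous_image) (auto intro: holomorphic_on_imp_continuous_on holomorphic_on_subset)
  then obtain B where "\<forall>y\<in>h ` cball 0 R. norm y \<le> B"
    using compact_imp_bounded bounded_iff by metis
  then have "norm (h H) \<le> B" if "norm H \<le> R" for H using that by simp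
  then show ?case by blast
next
  case (amplitude_poly q)
  then show ?case using coord_poly_bounded[OF amplitude_poly] coord_poly_nonneg[OF amplitude_poly]
    by (metis abs_of_nonneg norm_of_real)
next
  case (amplitude_powr q a b)
  obtain B where B: "\<And>x. (\<forall>i\<in>N. 0 \<le> x i \<and> x i \<le> 1) \<Longrightarrow> q x \<le> B"
    using coord_poly_bounded[OF amplitude_powr] by blast
  \<comment> \<open>The base is at least 1, so the modulus grows with the real part of the exponent;
    replacing that by the nonnegative \<open>norm a + norm b * R\<close> also makes it monotone in
    the base.\<close>
  have "norm (complex_of_real (1 + q x) powr (a + b * H)) \<le> (1 + B) powr (norm a + norm b * R)"
    if x: "\<forall>i\<in>N. 0 \<le> x i \<and> x i \<le> 1" and H: "norm H \<le> R" for x H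
  proof -
    have q0: "0 \<le> q x" using coord_poly_nonneg[OF amplitude_powr] x by blast
    have "Re (a + b * H) \<le> norm (a + b * H)" by (rule complex_Re_le_cmod)
    also have "\<dots> \<le> norm a + norm b * norm H" by (metis norm_mult norm_triangle_ineq)
    also have "\<dots> \<le> norm a + norm b * R" using H by (simp add: mult_left_mono)
    finally have Re: "Re (a + b * H) \<le> norm a + norm b * R" .
    have R0: "0 \<le> norm a + norm b * R" using H by (smt (verit) norm_ge_zero mult_nonneg_nonneg)
    have "norm (complex_of_real (1 + q x) powr (a + b * H)) = (1 + q x) powr Re (a + b * H)"
      using norm_powr_real_powr[of "complex_of_real (1 + q x)" "a + b * H"] q0
      by (simp add: in_Reals_norm del: of_real_add)
    also have "\<dots> \<le> (1 + q x) powr (norm a + norm b * R)" using Re q0 by (intro powr_mono) auto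
    also have "\<dots> \<le> (1 + B) powr (norm a + norm b * R)"
      using q0 B[OF x] R0 by (intro powr_mono2) auto
    finally show ?thesis .
  qed
  then show ?case by blast
next
  case (amplitude_add \<Phi> \<Psi>)
  then show ?case by (meson norm_triangle_le add_mono)
next
  case (amplitude_mult \<Phi> \<Psi>)
  then obtain B C where "\<And>x H. (\<forall>i\<in>N. 0 \<le> x i \<and> x i \<le> 1) \<Longrightarrow> norm H \<le> R \<Longrightarrow> norm (\<Phi> x H) \<le> B"
    "\<And>x H. (\<forall>i\<in>N. 0 \<le> x i \<and> x i \<le> 1) \<Longrightarrow> norm H \<le> R \<Longrightarrow> norm (\<Psi> x H) \<le> C" by blast
  then have "norm (\<Phi> x H * \<Psi> x H) \<le> B * C"
    if "\<forall>i\<in>N. 0 \<le> x i \<and> x i \<le> 1" "norm H \<le> R" for x H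
    unfolding norm_mult using that by (intro mult_mono) (meson order_trans norm_ge_zero)+
  then show ?case by blast
qed

lemma amplitude_derivative:
  "amplitude N \<Phi> \<Longrightarrow> \<exists>\<Phi>'. amplitude N \<Phi>' \<and>
     (\<forall>x H. (\<forall>i\<in>N. 0 \<le> x i) \<longrightarrow> ((\<lambda>t. \<Phi> (x(j := t)) H) has_vector_derivative \<Phi>' x H) (at (x j)))"
proof (induction rule: amplitude.induct)
  case (amplitude_entire h)
  have "amplitude N (\<lambda>_ _. 0)" by (rule amplitude.amplitude_entire) simp
  then show ?case by (intro exI[of _ "\<lambda>_ _. 0"]) auto
next
  case (amplitude_poly q)
  then obtain q' where q': "coord_poly N q'"
    "\<And>x. ((\<lambda>t. q (x(j := t))) has_real_derivative q' x) (at (x j))"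
    using coord_poly_derivative by blast
  have "((\<lambda>t. complex_of_real (q (x(j := t)))) has_vector_derivative complex_of_real (q' x)) (at (x j))" for x
    using q'(2)[of x] by (rule has_vector_derivative_of_real)
  then show ?case using amplitude.amplitude_poly[OF q'(1)] by blast
next
  case (amplitude_powr q a b)
  then obtain q' where q': "coord_poly N q'"
    "\<And>x. ((\<lambda>t. q (x(j := t))) has_real_derivative q' x) (at (x j))"
    using coord_poly_derivative by blast
  \<comment> \<open>Differentiating lowers the exponent by one and brings down
    \<open>a + b * H\<close>. This is why amplitudes admit arbitrary shifts \<open>a\<close> and
    entire factors in \<open>H\<close>.\<close>
  let ?\<Phi>' = "\<lambda>x H. complex_of_real (q' x) * ((a + b * H) * complex_of_real (1 + q x) powr ((a - 1) + b * H))"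
  have "((\<lambda>t. complex_of_real (1 + q (x(j := t))) powr (a + b * H)) has_vector_derivative ?\<Phi>' x H) (at (x j))"
    if x: "\<forall>i\<in>N. 0 \<le> x i" for x H
  proof -
    have "0 < 1 + q x" using coord_poly_nonneg[OF amplitude_powr x] by linarith
    then have "complex_of_real (1 + q (x(j := x j))) \<notin> \<real>\<^sub>\<le>\<^sub>0" by (simp add: complex_nonpos_Reals_iff)
    then have g: "((\<lambda>w. w powr (a + b * H)) has_field_derivative
        (a + b * H) * complex_of_real (1 + q (x(j := x j))) powr (a + b * H - 1))
        (at (complex_of_real (1 + q (x(j := x j)))))"
      by (rule has_field_derivative_powr)
    have "((\<lambda>t. 1 + q (x(j := t))) has_real_derivative q' x) (at (x j))"
      using DERIV_add[OF DERIV_const q'(2)[of x]] by simp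
    then have f: "((\<lambda>t. complex_of_real (1 + q (x(j := t)))) has_vector_derivative complex_of_real (q' x)) (at (x j))"
      by (rule has_vector_derivative_of_real)
    have e: "?\<Phi>' x H = complex_of_real (q' x) * ((a + b * H) * complex_of_real (1 + q (x(j := x j))) powr (a + b * H - 1))"
      by (simp add: algebra_simps)
    show ?thesis unfolding e using field_vector_diff_chain_at[OF f g] unfolding o_def .
  qed
  moreover have "amplitude N ?\<Phi>'"
    using q'(1) amplitude_powr by (intro amplitude.intros) (auto intro!: holomorphic_intros amplitude.intros)
  ultimately show ?case by blast
next
  case (amplitude_add \<Phi> \<Psi>)
  then obtain \<Phi>' \<Psi>' where *: "amplitude N \<Phi>'" "amplitude N \<Psi>'"
    "\<And>x H. \<forall>i\<in>N. 0 \<le> x i \<Longrightarrow> ((\<lambda>t. \<Phi> (x(j := t)) H) has_vector_derivative \<Phi>' x H) (at (x j))"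
    "\<And>x H. \<forall>i\<in>N. 0 \<le> x i \<Longrightarrow> ((\<lambda>t. \<Psi> (x(j := t)) H) has_vector_derivative \<Psi>' x H) (at (x j))" by blast
  have "((\<lambda>t. \<Phi> (x(j := t)) H + \<Psi> (x(j := t)) H) has_vector_derivative
      \<Phi>' x H + \<Psi>' x H) (at (x j))" if "\<forall>i\<in>N. 0 \<le> x i" for x H
    by (rule has_vector_derivative_add[OF *(3)[OF that] *(4)[OF that]])
  then show ?case using amplitude.amplitude_add[OF *(1,2)] by blast
next
  case (amplitude_mult \<Phi> \<Psi>)
  then obtain \<Phi>' \<Psi>' where *: "amplitude N \<Phi>'" "amplitude N \<Psi>'"
    "\<And>x H. \<forall>i\<in>N. 0 \<le> x i \<Longrightarrow> ((\<lambda>t. \<Phi> (x(j := t)) H) has_vector_derivative \<Phi>' x H) (at (x j))"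
    "\<And>x H. \<forall>i\<in>N. 0 \<le> x i \<Longrightarrow> ((\<lambda>t. \<Psi> (x(j := t)) H) has_vector_derivative \<Psi>' x H) (at (x j))" by blast
  have "((\<lambda>t. \<Phi> (x(j := t)) H * \<Psi> (x(j := t)) H) has_vector_derivative
      \<Phi> x H * \<Psi>' x H + \<Phi>' x H * \<Psi> x H) (at (x j))" if "\<forall>i\<in>N. 0 \<le> x i" for x H
    using has_vector_derivative_mult[OF *(3)[OF that] *(4)[OF that], of H H] by simp
  moreover have "amplitude N (\<lambda>x H. \<Phi> x H * \<Psi>' x H + \<Phi>' x H * \<Psi> x H)"
    by (intro amplitude.intros * amplitude_mult.hyps)
  ultimately show ?case by blast
qed

section \<open>Parameter integrals and multiple Mellin transforms\<close>

text \<open>Differentiation under the integral sign. A local bound on \<open>f\<close> suffices: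
  Cauchy's inequality turns it into a bound on the derivative on a smaller ball, this bounds the
  difference quotients, and dominated convergence applies.\<close>

lemma holomorphic_on_integral:
  fixes f :: "'a \<Rightarrow> complex \<Rightarrow> complex"
  assumes S: "open S"
    and meas: "\<And>H. H \<in> S \<Longrightarrow> (\<lambda>x. f x H) \<in> borel_measurable M"
    and hol: "\<And>x. x \<in> space M \<Longrightarrow> f x holomorphic_on S"
    and bound: "\<And>H. H \<in> S \<Longrightarrow> \<exists>r>0. \<exists>g. ball H r \<subseteq> S \<and> integrable M g \<and>
                  (\<forall>x\<in>space M. \<forall>z\<in>ball H r. norm (f x z) \<le> g x)"
  shows "(\<lambda>H. \<integral>x. f x H \<partial>M) holomorphic_on S"
proof -
  have "\<exists>D. ((\<lambda>H. \<integral>x. f x H \<partial>M) has_field_derivative D) (at H)" if H: "H \<in> S" for H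
  proof -
    obtain r g where r: "0 < r" "ball H r \<subseteq> S" and g: "integrable M g"
      and fg: "\<And>x z. x \<in> space M \<Longrightarrow> z \<in> ball H r \<Longrightarrow> norm (f x z) \<le> g x"
      using bound[OF H] by blast
    let ?B = "ball H (r / 2)"
    have B: "?B \<subseteq> ball H r" using r by auto
    have int: "integrable M (\<lambda>x. f x z)" if "z \<in> ball H r" for z
    proof (rule Bochner_Integration.integrable_bound[OF g])
      show "(\<lambda>x. f x z) \<in> borel_measurable M" using meas r that by blast
      show "AE x in M. norm (f x z) \<le> norm (g x)"
        using fg[OF _ that] by (intro AE_I2) (metis abs_ge_self order_trans real_norm_def)
    qed
    have der: "(f x has_field_derivative deriv (f x) z) (at z)" if "x \<in> space M" "z \<in> ball H r" for x z
      using holomorphic_derivI[OF hol S] that r by blast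
    \<comment> \<open>Radii: \<open>z\<close> is within \<open>r / 2\<close> of \<open>H\<close>,
      and \<open>1/2 + 1/3 < 1\<close>, so the disk of radius \<open>r / 3\<close> about
      \<open>z\<close> stays where \<open>g\<close> dominates.\<close>
    have Cauchy: "norm (deriv (f x) z) \<le> g x / (r / 3)" if x: "x \<in> space M" and z: "z \<in> ?B" for x z
    proof -
      have sub: "cball z (r / 3) \<subseteq> ball H r"
      proof
        fix w assume "w \<in> cball z (r / 3)"
        then show "w \<in> ball H r" using z r dist_triangle[of H w z] by auto
      qed
      have h: "f x holomorphic_on cball z (r / 3)" 
        by (rule holomorphic_on_subset[OF hol[OF x]]) (use sub r in blast)
      have "norm ((deriv ^^ 1) (f x) z) \<le> fact 1 * g x / (r / 3) ^ 1"
      proof (rule Cauchy_inequality)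
        show "f x holomorphic_on ball z (r / 3)" by (rule holomorphic_on_subset[OF h]) auto
        show "continuous_on (cball z (r / 3)) (f x)" using h by (rule holomorphic_on_imp_continuous_on)
        show "norm (f x w) \<le> g x" if "norm (z - w) = r / 3" for w
          using that sub by (intro fg[OF x]) (auto simp: dist_norm)
      qed (use r in auto)
      then show ?thesis by simp
    qed
    have lip: "norm (f x z - f x H) \<le> g x / (r / 3) * norm (z - H)" if x: "x \<in> space M" and z: "z \<in> ?B" for x z
    proof (rule field_differentiable_bound[of ?B])
      show "(f x has_field_derivative deriv (f x) w) (at w within ?B)" if "w \<in> ?B" for w
        by (rule has_field_derivative_at_within[OF der[OF x]]) (use B that in blast)
      show "norm (deriv (f x) w) \<le> g x / (r / 3)" if "w \<in> ?B" for w
        by (rule Cauchy[OF x that])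
      show "H \<in> ?B" using r by simp
    qed (use z in simp_all)
    let ?D = "\<integral>x. deriv (f x) H \<partial>M"
    have "((\<lambda>H. \<integral>x. f x H \<partial>M) has_field_derivative ?D) (at H within ?B)"
      unfolding has_field_derivative_iff tendsto_at_iff_sequentially
    proof (intro allI impI)
      fix X assume X: "\<forall>i. X i \<in> ?B - {H}" "X \<longlonglongrightarrow> H"
      let ?q = "\<lambda>n x. (f x (X n) - f x H) / (X n - H)"
      have XB: "X n \<in> ball H r" for n using X(1) B by blast
      have HB: "H \<in> ball H r" using r by simp
      have q: "(\<integral>x. ?q n x \<partial>M) = ((\<integral>x. f x (X n) \<partial>M) - (\<integral>x. f x H \<partial>M)) / (X n - H)" for n
        using int[OF XB] int[OF HB] by simp
      have qm: "?q n \<in> borel_measurable M" for n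
        using int[OF XB, of n] int[OF HB] by (intro borel_measurable_divide borel_measurable_diff) auto
      have lim: "(\<lambda>n. ?q n x) \<longlonglongrightarrow> deriv (f x) H" if x: "x \<in> space M" for x
      proof -
        have "((\<lambda>y. (f x y - f x H) / (y - H)) \<longlongrightarrow> deriv (f x) H) (at H within ?B)"
          using has_field_derivative_at_within[OF der[OF x HB]] unfolding has_field_derivative_iff .
        then show ?thesis using X unfolding tendsto_at_iff_sequentially o_def by blast
      qed
      have "(\<lambda>n. \<integral>x. ?q n x \<partial>M) \<longlonglongrightarrow> ?D"
      proof (rule integral_dominated_convergence[where w = "\<lambda>x. g x / (r / 3)"])
        show "(\<lambda>x. deriv (f x) H) \<in> borel_measurable M"
          by (rule borel_measurable_LIMSEQ_metric[OF qm lim])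
        show "AE x in M. (\<lambda>n. ?q n x) \<longlonglongrightarrow> deriv (f x) H" using lim by auto
        show "AE x in M. norm (?q n x) \<le> g x / (r / 3)" for n
        proof (rule AE_I2)
          fix x assume x: "x \<in> space M"
          have "norm (?q n x) = norm (f x (X n) - f x H) / norm (X n - H)" by (rule norm_divide)
          also have "\<dots> \<le> g x / (r / 3)"
            using lip[OF x, of "X n"] X(1)[rule_format, of n] by (subst pos_divide_le_eq) auto
          finally show "norm (?q n x) \<le> g x / (r / 3)" .
        qed
      qed (use g qm in auto)
      then show "((\<lambda>y. ((\<integral>x. f x y \<partial>M) - (\<integral>x. f x H \<partial>M)) / (y - H)) \<circ> X) \<longlonglongrightarrow> ?D"
        unfolding o_def q .
    qed
    then show ?thesis using r at_within_open[of H ?B] by (metis centre_in_ball half_gt_zero open_ball)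
  qed
  then show ?thesis unfolding holomorphic_on_open[OF S] by blast
qed

section \<open>Mellin integrals over the unit cube and integration by parts\<close>

definition open_cube :: "nat set \<Rightarrow> (nat \<Rightarrow> real) set" where
  "open_cube N = {x. \<forall>i\<in>N. 0 < x i \<and> x i < 1}"

definition mellin_integrand ::
    "nat set \<Rightarrow> (nat \<Rightarrow> real) \<Rightarrow> (nat \<Rightarrow> real) \<Rightarrow> ((nat \<Rightarrow> real) \<Rightarrow> complex \<Rightarrow> complex) \<Rightarrow>
     complex \<Rightarrow> (nat \<Rightarrow> real) \<Rightarrow> complex" where
  "mellin_integrand N a b \<Phi> H x = indicat_real (open_cube N) x *\<^sub>R
     ((\<Prod>j\<in>N. complex_of_real (x j) powr (of_real (a j) + of_real (b j) * H)) * \<Phi> x H)"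

definition mellin ::
    "nat set \<Rightarrow> (nat \<Rightarrow> real) \<Rightarrow> (nat \<Rightarrow> real) \<Rightarrow> ((nat \<Rightarrow> real) \<Rightarrow> complex \<Rightarrow> complex) \<Rightarrow>
     complex \<Rightarrow> complex" where
  "mellin N a b \<Phi> H = (\<integral>x. mellin_integrand N a b \<Phi> H x \<partial>lebesgue_on_coords N)"

lemma indicator_open_cube:
  "finite N \<Longrightarrow> indicator (open_cube N) x = (\<Prod>j\<in>N. indicat_real {0<..<1} (x j))"
  by (induction N rule: finite_induct) (auto simp: open_cube_def indicator_def)

lemma integrable_powr_unit_interval:
  assumes "-1 < (p :: real)"
  shows "integrable lborel (\<lambda>y. indicat_real {0<..<1} y * y powr p)"
proof -
  have "(\<lambda>y::real. y powr p) integrable_on {0..1}"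
    using assms by (intro integrable_on_powr_from_0) auto
  then have "(\<lambda>y::real. y powr p) integrable_on {0<..<1}"
    by (simp add: integrable_on_Icc_iff_Ioo)
  then have "(\<lambda>y::real. y powr p) absolutely_integrable_on {0<..<1}"
    by (intro nonnegative_absolutely_integrable_1) auto
  then show ?thesis
    unfolding set_integrable_def by (subst (asm) integrable_completion) auto
qed

lemma mellin_integrand_measurable:
  assumes N: "finite N" and \<Phi>: "amplitude N \<Phi>"
  shows "mellin_integrand N a b \<Phi> H \<in> borel_measurable (lebesgue_on_coords N)"
proof -
  note [measurable] = amplitude_measurable[OF \<Phi>, of H] measurable_coord
  have [measurable]: "indicat_real (open_cube N) \<in> borel_measurable (lebesgue_on_coords N)"
    unfolding indicator_open_cube[OF N, abs_def] by measurable
  show ?thesis unfolding mellin_integrand_def powr_def by measurable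
qed

text \<open>Since \<open>0 < x j < 1\<close> and \<open>b j\<close> is nonnegative, each monomial
  has its largest modulus on the edge \<open>Re H = \<sigma>\<close>, where the product is still
  integrable. The bound \<open>R\<close> controls the amplitude.\<close>

lemma mellin_dominating:
  assumes N: "finite N" and \<Phi>: "amplitude N \<Phi>"
    and b: "\<forall>j\<in>N. 0 \<le> b j" and ab: "\<forall>j\<in>N. -1 < a j + b j * \<sigma>"
  shows "\<exists>g. integrable (lebesgue_on_coords N) g \<and>
    (\<forall>x H. norm H \<le> R \<longrightarrow> \<sigma> \<le> Re H \<longrightarrow> norm (mellin_integrand N a b \<Phi> H x) \<le> g x)"
proof -
  interpret product_sigma_finite "\<lambda>_::nat. lborel :: real measure" ..
  obtain B where B: "\<And>x H. (\<forall>i\<in>N. 0 \<le> x i \<and> x i \<le> 1) \<Longrightarrow> norm H \<le> R \<Longrightarrow> norm (\<Phi> x H) \<le> B"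
    using amplitude_bounded[OF \<Phi>] by blast
  let ?p = "\<lambda>x::nat \<Rightarrow> real. \<Prod>j\<in>N. indicat_real {0<..<1} (x j) * x j powr (a j + b j * \<sigma>)"
  have "integrable (lebesgue_on_coords N) ?p"
    by (rule product_integrable_prod[OF N]) (intro integrable_powr_unit_interval ab[rule_format])
  then have "integrable (lebesgue_on_coords N) (\<lambda>x. ?p x * B)" by simp
  moreover have "norm (mellin_integrand N a b \<Phi> H x) \<le> ?p x * B"
    if H: "norm H \<le> R" "\<sigma> \<le> Re H" for x H
  proof (cases "x \<in> open_cube N")
    case True
    then have x: "0 < x i" "x i < 1" if "i \<in> N" for i using that by (auto simp: open_cube_def)
    have "norm (mellin_integrand N a b \<Phi> H x)
        = (\<Prod>j\<in>N. norm (complex_of_real (x j) powr (of_real (a j) + of_real (b j) * H))) * norm (\<Phi> x H)"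
      unfolding mellin_integrand_def norm_scaleR norm_mult prod_norm[symmetric] using True by simp
    also have "\<dots> = (\<Prod>j\<in>N. x j powr (a j + b j * Re H)) * norm (\<Phi> x H)"
    proof (intro arg_cong2[where f = "(*)"] prod.cong refl)
      fix j assume "j \<in> N"
      then show "norm (complex_of_real (x j) powr (of_real (a j) + of_real (b j) * H)) = x j powr (a j + b j * Re H)"
        using x[of j] by (subst norm_powr_real_powr) auto
    qed
    also have "\<dots> \<le> (\<Prod>j\<in>N. x j powr (a j + b j * \<sigma>)) * B"
    proof (rule mult_mono)
      show "(\<Prod>j\<in>N. x j powr (a j + b j * Re H)) \<le> (\<Prod>j\<in>N. x j powr (a j + b j * \<sigma>))"
        using x b H(2) by (intro prod_mono conjI powr_mono') (auto intro: mult_left_mono simp: less_imp_le)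
      show "norm (\<Phi> x H) \<le> B" using x by (intro B H) (auto intro: less_imp_le)
    qed (auto intro: prod_nonneg)
    also have "\<dots> = ?p x * B" using x by simp
    finally show ?thesis .
  next
    case False
    then have "?p x = 0"
      using indicator_open_cube[OF N, of x] by (simp add: prod.distrib)
    then show ?thesis using False by (simp add: mellin_integrand_def)
  qed
  ultimately show ?thesis by blast
qed

lemma mellin_integrable:
  assumes "finite N" "amplitude N \<Phi>" "\<forall>j\<in>N. 0 \<le> b j" "\<forall>j\<in>N. -1 < a j + b j * Re H"
  shows "integrable (lebesgue_on_coords N) (mellin_integrand N a b \<Phi> H)"
proof -
  obtain g where g: "integrable (lebesgue_on_coords N) g"
    and g': "\<forall>x H'. norm H' \<le> norm H \<longrightarrow> Re H \<le> Re H' \<longrightarrow> norm (mellin_integrand N a b \<Phi> H' x) \<le> g x"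
    using mellin_dominating[where R = "norm H", OF assms] by (elim exE conjE)
  have le: "norm (mellin_integrand N a b \<Phi> H x) \<le> norm (g x)" for x
    using g'[rule_format, of H x] by simp
  show ?thesis
  proof (rule Bochner_Integration.integrable_bound[OF g])
    show "AE x in lebesgue_on_coords N. norm (mellin_integrand N a b \<Phi> H x) \<le> norm (g x)"
      by (rule AE_I2) (rule le)
  qed (intro mellin_integrand_measurable assms)
qed

lemma mellin_holomorphic:
  assumes N: "finite N" and \<Phi>: "amplitude N \<Phi>"
    and b: "\<forall>j\<in>N. 0 \<le> b j" and ab: "\<forall>j\<in>N. -1 < a j + b j * \<sigma>"
  shows "mellin N a b \<Phi> holomorphic_on {H. \<sigma> < Re H}"
  unfolding mellin_def[abs_def]
proof (rule holomorphic_on_integral)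
  show "open {H. \<sigma> < Re H}" by (rule open_halfspace_Re_gt)
  show "mellin_integrand N a b \<Phi> H \<in> borel_measurable (lebesgue_on_coords N)" for H
    by (rule mellin_integrand_measurable[OF N \<Phi>])
  fix x
  show "(\<lambda>H. mellin_integrand N a b \<Phi> H x) holomorphic_on {H. \<sigma> < Re H}"
  proof (cases "x \<in> open_cube N")
    case True
    then have "\<Phi> x holomorphic_on UNIV"
      by (intro amplitude_holomorphic[OF \<Phi>]) (auto simp: open_cube_def intro: less_imp_le)
    then have 1: "\<Phi> x holomorphic_on {H. \<sigma> < Re H}" by (rule holomorphic_on_subset) auto
    have "(\<lambda>H. \<Prod>j\<in>N. complex_of_real (x j) powr (of_real (a j) + of_real (b j) * H)) holomorphic_on {H. \<sigma> < Re H}"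
    proof (rule holomorphic_on_prod)
      fix j assume "j \<in> N"
      then have "complex_of_real (x j) \<noteq> 0" using True by (auto simp: open_cube_def)
      then show "(\<lambda>H. complex_of_real (x j) powr (of_real (a j) + of_real (b j) * H)) holomorphic_on {H. \<sigma> < Re H}"
        unfolding powr_def by (auto intro!: holomorphic_intros)
    qed
    then show ?thesis using 1 True by (auto simp: mellin_integrand_def intro: holomorphic_intros)
  qed (simp add: mellin_integrand_def)
next
  fix H assume H: "H \<in> {H. \<sigma> < Re H}"
  obtain r where r: "0 < r" "ball H r \<subseteq> {H. \<sigma> < Re H}"
    using H open_halfspace_Re_gt[of \<sigma>] open_contains_ball by blast
  obtain g where g: "integrable (lebesgue_on_coords N) g"
    and g': "\<forall>x z. norm z \<le> norm H + r \<longrightarrow> \<sigma> \<le> Re z \<longrightarrow> norm (mellin_integrand N a b \<Phi> z x) \<le> g x"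
    using mellin_dominating[where R = "norm H + r", OF assms] by (elim exE conjE)
  have "norm (mellin_integrand N a b \<Phi> z x) \<le> g x" if "z \<in> ball H r" for z x
  proof (rule g'[rule_format])
    show "norm z \<le> norm H + r"
      using that norm_triangle_sub[of z H] by (simp add: dist_norm norm_minus_commute)
    show "\<sigma> \<le> Re z" using r that by force
  qed
  then show "\<exists>r>0. \<exists>g. ball H r \<subseteq> {H. \<sigma> < Re H} \<and> integrable (lebesgue_on_coords N) g \<and>
      (\<forall>x\<in>space (lebesgue_on_coords N). \<forall>z\<in>ball H r. norm (mellin_integrand N a b \<Phi> z x) \<le> g x)"
    using r g by blast
qed

text \<open>The integrand is the derivative of \<open>?K\<close>. Subtracting
  \<open>y * \<phi> 1\<close> there makes the primitive vanish at both ends, so the boundary value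
  appears under the integral instead of beside it.\<close>

lemma mellin_by_parts_1d:
  fixes \<phi> \<phi>' :: "real \<Rightarrow> complex"
  assumes e: "-1 < Re e" and \<phi>: "\<And>y. 0 \<le> y \<Longrightarrow> (\<phi> has_vector_derivative \<phi>' y) (at y)"
  shows "(\<integral>y. indicat_real {0<..<1} y *\<^sub>R ((e + 1) * (complex_of_real y powr e * \<phi> y) - \<phi> 1
           + complex_of_real y powr (e + 1) * \<phi>' y) \<partial>lborel) = 0"
proof -
  let ?k = "\<lambda>y. (e + 1) * (complex_of_real y powr e * \<phi> y) - \<phi> 1 + complex_of_real y powr (e + 1) * \<phi>' y"
  let ?K = "\<lambda>y. complex_of_real y powr (e + 1) * \<phi> y - of_real y * \<phi> 1"
  have "(?k has_integral ?K 1 - ?K 0) {0..1}"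
  proof (rule fundamental_theorem_of_calculus_interior)
    have "continuous_on {0..1} \<phi>"
      using has_vector_derivative_continuous[OF \<phi>] by (intro continuous_at_imp_continuous_on) auto
    then show "continuous_on {0..1} ?K"
      using e by (intro continuous_intros) auto
    fix y :: real assume y: "y \<in> {0<..<1}"
    then have "complex_of_real y \<notin> \<real>\<^sub>\<le>\<^sub>0" by (simp add: complex_nonpos_Reals_iff)
    from has_field_derivative_powr[OF this, of "e + 1"]
    have "((\<lambda>z. z powr (e + 1)) has_field_derivative (e + 1) * complex_of_real y powr e) (at (complex_of_real y))"
      by simp
    then have 1: "((\<lambda>y. complex_of_real y powr (e + 1)) has_vector_derivative (e + 1) * complex_of_real y powr e) (at y)"
      by (rule has_vector_derivative_real_field)
    have 2: "((\<lambda>y. complex_of_real y * \<phi> 1) has_vector_derivative 1 * \<phi> 1) (at y)"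
      by (intro has_vector_derivative_mult_left) (auto intro!: derivative_eq_intros)
    show "(?K has_vector_derivative ?k y) (at y)"
      using has_vector_derivative_diff[OF has_vector_derivative_mult[OF 1 \<phi>[of y]] 2] y
      by (simp add: algebra_simps)
  qed simp
  then have I: "integral {0<..<1} ?k = 0"
    by (simp add: has_integral_Icc_iff_Ioo integral_unique)
  show ?thesis
  proof (cases "set_integrable lborel {0<..<1} ?k")
    case True
    then show ?thesis using set_borel_integral_eq_integral(2)[OF True] I
      by (simp add: set_lebesgue_integral_def)
  next
    \<comment> \<open>The Lebesgue integral of a non-integrable function is 0 by convention, so the
      claim holds in this case too.\<close>
    case False
    then show ?thesis unfolding set_integrable_def by (rule not_integrable_integral_eq)
  qed
qed

text \<open>The boundary term at \<open>x j = 1\<close> is kept as an integral over the same cube, with exponent \<open>0\<close> and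
  integrand independent of \<open>x j\<close>, so the index set never changes.\<close>

lemma mellin_recursion:
  assumes N: "finite N" and j: "j \<in> N" and \<Phi>: "amplitude N \<Phi>" and \<Phi>': "amplitude N \<Phi>'"
    and der: "\<And>x H. (\<forall>i\<in>N. 0 \<le> x i) \<Longrightarrow>
          ((\<lambda>t. \<Phi> (x(j := t)) H) has_vector_derivative \<Phi>' x H) (at (x j))"
    and b: "\<forall>i\<in>N. 0 \<le> b i" and ab: "\<forall>i\<in>N. -1 < a i + b i * Re H"
  shows "(of_real (a j) + of_real (b j) * H + 1) * mellin N a b \<Phi> H
     = mellin N (a(j := 0)) (b(j := 0)) (\<lambda>x. \<Phi> (x(j := 1))) H
       - mellin N (a(j := a j + 1)) b \<Phi>' H"
proof -
  interpret product_sigma_finite "\<lambda>_::nat. lborel :: real measure" ..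
  let ?M = "lebesgue_on_coords N"
  define e where "e = of_real (a j) + of_real (b j) * H"
  define f0 where "f0 = mellin_integrand N a b \<Phi> H"
  define f1 where "f1 = mellin_integrand N (a(j := 0)) (b(j := 0)) (\<lambda>x. \<Phi> (x(j := 1))) H"
  define f2 where "f2 = mellin_integrand N (a(j := a j + 1)) b \<Phi>' H"
  obtain N' where N': "N = insert j N'" "j \<notin> N'" using j by (meson mk_disjoint_insert)
  have fin: "finite N'" using N N' by simp
  have \<Phi>1: "amplitude N (\<lambda>x. \<Phi> (x(j := 1)))"
  proof (rule amplitude_subst[OF \<Phi>])
    fix i assume "i \<in> N"
    then show "coord_poly N (\<lambda>x. (x(j := 1)) i)"
      by (cases "i = j") (auto intro: coord_poly.intros)
  qed
  have i0: "integrable ?M f0" unfolding f0_def using N \<Phi> b ab by (rule mellin_integrable)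
  have i1: "integrable ?M f1" unfolding f1_def
    by (rule mellin_integrable[OF N \<Phi>1]) (use b ab in auto)
  have i2: "integrable ?M f2" unfolding f2_def
    by (rule mellin_integrable[OF N \<Phi>']) (use b ab in \<open>auto simp: less_diff_eq intro: less_trans\<close>)
  let ?h = "\<lambda>x. (e + 1) * f0 x - f1 x + f2 x"
  have ih: "integrable ?M ?h" using i0 i1 i2 by simp
  \<comment> \<open>By Fubini it is enough that the integral in direction \<open>j\<close> vanishes.
    The powers in the other coordinates form a common factor \<open>?C\<close> of all three terms,
    and what remains is the one-dimensional identity.\<close>
  have inner: "(\<integral>y. ?h (x(j := y)) \<partial>lborel) = 0" for x
  proof (cases "x \<in> open_cube N'")
    case False
    then have "x(j := y) \<notin> open_cube N" for y using N' by (auto simp: open_cube_def split: if_splits)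
    then show ?thesis by (simp add: f0_def f1_def f2_def mellin_integrand_def)
  next
    case True
    let ?C = "\<Prod>i\<in>N'. complex_of_real (x i) powr (of_real (a i) + of_real (b i) * H)"
    let ?\<phi> = "\<lambda>y. \<Phi> (x(j := y)) H" and ?\<phi>' = "\<lambda>y. \<Phi>' (x(j := y)) H"
    have C: "(\<Prod>i\<in>N'. complex_of_real ((x(j := y)) i) powr (of_real (a' i) + of_real (b' i) * H)) = ?C"
      if "\<And>i. i \<in> N' \<Longrightarrow> a' i = a i" "\<And>i. i \<in> N' \<Longrightarrow> b' i = b i" for a' b' y
      using that N'(2) by (intro prod.cong) auto
    have C1: "(\<Prod>i\<in>N'. complex_of_real ((x(j := y)) i) powr
        (of_real ((a(j := 0)) i) + of_real ((b(j := 0)) i) * H)) = ?C" for y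
      by (rule C) (use N'(2) in auto)
    have C2: "(\<Prod>i\<in>N'. complex_of_real ((x(j := y)) i) powr
        (of_real ((a(j := a j + 1)) i) + of_real (b i) * H)) = ?C" for y
      by (rule C) (use N'(2) in auto)
    have cube: "x(j := y) \<in> open_cube N \<longleftrightarrow> y \<in> {0<..<1}" for y
      using True N' by (auto simp: open_cube_def)
    have "?h (x(j := y)) = ?C * (indicat_real {0<..<1} y *\<^sub>R ((e + 1) * (complex_of_real y powr e * ?\<phi> y) - ?\<phi> 1
           + complex_of_real y powr (e + 1) * ?\<phi>' y))" for y
    proof (cases "y \<in> {0<..<1}")
      case True
      then have xc: "x(j := y) \<in> open_cube N" using cube by simp
      have "f0 (x(j := y)) = complex_of_real y powr e * ?C * ?\<phi> y"
        using xc fin N'(2) C[of a b] unfolding f0_def mellin_integrand_def N'(1) e_def by simp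
      moreover have "f1 (x(j := y)) = ?C * ?\<phi> 1"
        using xc fin N'(2) C1[of y] True unfolding f1_def mellin_integrand_def N'(1)
        by simp
      moreover have "f2 (x(j := y)) = complex_of_real y powr (e + 1) * ?C * ?\<phi>' y"
        using xc fin N'(2) C2[of y] unfolding f2_def mellin_integrand_def N'(1) e_def
        by (simp add: add_ac)
      ultimately show ?thesis using True by (simp add: algebra_simps)
    next
      case False
      then have "x(j := y) \<notin> open_cube N" using cube by simp
      then show ?thesis using False by (simp add: f0_def f1_def f2_def mellin_integrand_def)
    qed
    then have "(\<integral>y. ?h (x(j := y)) \<partial>lborel) = ?C * (\<integral>y. indicat_real {0<..<1} y *\<^sub>R
        ((e + 1) * (complex_of_real y powr e * ?\<phi> y) - ?\<phi> 1 + complex_of_real y powr (e + 1) * ?\<phi>' y) \<partial>lborel)"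
      by (simp only: integral_mult_right_zero)
    also have "\<dots> = ?C * 0"
    proof (intro arg_cong2[where f = "(*)"] refl mellin_by_parts_1d)
      show "-1 < Re e" using ab j by (simp add: e_def)
      fix y :: real assume "0 \<le> y"
      then have "\<forall>i\<in>N. 0 \<le> (x(j := y)) i"
        using True N' by (auto simp: open_cube_def intro: less_imp_le)
      from der[OF this, of H] show "(?\<phi> has_vector_derivative ?\<phi>' y) (at y)"
        by (simp only: fun_upd_upd fun_upd_same)
    qed
    finally show ?thesis by simp
  qed
  have "(\<integral>x. ?h x \<partial>?M) = 0"
    using product_integral_insert[OF fin N'(2) ih[unfolded N'(1)]] inner by (simp add: N'(1))
  then have "(e + 1) * integral\<^sup>L ?M f0 - integral\<^sup>L ?M f1 + integral\<^sup>L ?M f2 = 0"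
    using i0 i1 i2 by simp
  then show ?thesis
    by (simp add: mellin_def f0_def f1_def f2_def e_def algebra_simps)
qed

section \<open>Meromorphic continuation of multiple Mellin transforms\<close>

text \<open>The factors \<open>1 / \<Gamma>\<close> absorb the denominators of the recursion, so that the normalized integral
  continues to an entire function and the poles are read off from the \<open>\<Gamma>\<close> factors.\<close>

definition normalized_mellin ::
    "nat set \<Rightarrow> (nat \<Rightarrow> real) \<Rightarrow> (nat \<Rightarrow> real) \<Rightarrow> ((nat \<Rightarrow> real) \<Rightarrow> complex \<Rightarrow> complex) \<Rightarrow>
     complex \<Rightarrow> complex" where
  "normalized_mellin N a b \<Phi> H =
     mellin N a b \<Phi> H * (\<Prod>j\<in>N. rGamma (of_real (a j) + of_real (b j) * H + 1))"

text \<open>The factor \<open>e + 1\<close> to be divided by is absorbed by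
  \<open>(e + 1) * rGamma (e + 2) = rGamma (e + 1)\<close>, where \<open>e\<close> is the exponent
  of \<open>x j\<close>. In the boundary term that exponent is 0 and contributes
  \<open>rGamma 1 = 1\<close>, hence the explicit \<open>rGamma\<close> in front of it.\<close>

lemma normalized_mellin_recursion:
  assumes N: "finite N" and j: "j \<in> N" and \<Phi>: "amplitude N \<Phi>" and \<Phi>': "amplitude N \<Phi>'"
    and der: "\<And>x H. (\<forall>i\<in>N. 0 \<le> x i) \<Longrightarrow>
          ((\<lambda>t. \<Phi> (x(j := t)) H) has_vector_derivative \<Phi>' x H) (at (x j))"
    and b: "\<forall>i\<in>N. 0 \<le> b i" and ab: "\<forall>i\<in>N. -1 < a i + b i * Re H"
  shows "normalized_mellin N a b \<Phi> H
     = rGamma (of_real (a j) + of_real (b j) * H + 2) *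
         normalized_mellin N (a(j := 0)) (b(j := 0)) (\<lambda>x. \<Phi> (x(j := 1))) H
       - normalized_mellin N (a(j := a j + 1)) b \<Phi>' H"
proof -
  let ?e = "of_real (a j) + of_real (b j) * H"
  let ?R = "\<Prod>i\<in>N - {j}. rGamma (of_real (a i) + of_real (b i) * H + 1)"
  have R: "(\<Prod>i\<in>N. rGamma (of_real (a' i) + of_real (b' i) * H + 1))
      = rGamma (of_real (a' j) + of_real (b' j) * H + 1) * ?R"
    if "\<And>i. i \<noteq> j \<Longrightarrow> a' i = a i" "\<And>i. i \<noteq> j \<Longrightarrow> b' i = b i" for a' b' :: "nat \<Rightarrow> real"
    using that by (subst prod.remove[OF N j]) (auto intro!: prod.cong)
  have G: "(?e + 1) * rGamma (?e + 2) = rGamma (?e + 1)"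
    using rGamma_plus1[of "?e + 1"] by (simp add: add.assoc)
  have rec: "(?e + 1) * mellin N a b \<Phi> H
     = mellin N (a(j := 0)) (b(j := 0)) (\<lambda>x. \<Phi> (x(j := 1))) H - mellin N (a(j := a j + 1)) b \<Phi>' H"
    by (rule mellin_recursion[OF N j \<Phi> \<Phi>' der b ab])
  have 0: "normalized_mellin N a b \<Phi> H = ((?e + 1) * mellin N a b \<Phi> H) * rGamma (?e + 2) * ?R"
    unfolding normalized_mellin_def by (subst R) (simp_all add: G[symmetric])
  have 1: "normalized_mellin N (a(j := 0)) (b(j := 0)) (\<lambda>x. \<Phi> (x(j := 1))) H
      = mellin N (a(j := 0)) (b(j := 0)) (\<lambda>x. \<Phi> (x(j := 1))) H * ?R"
    unfolding normalized_mellin_def by (subst R) simp_all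
  have 2: "normalized_mellin N (a(j := a j + 1)) b \<Phi>' H
      = mellin N (a(j := a j + 1)) b \<Phi>' H * (rGamma (?e + 2) * ?R)"
    unfolding normalized_mellin_def by (subst R) (simp_all add: algebra_simps)
  show ?thesis unfolding 0 1 2 rec by (simp add: algebra_simps)
qed

text \<open>\<open>d j\<close> is the number of integrations by parts in the variable \<open>j\<close> still needed for convergence
  on \<open>Re H > \<sigma>\<close>.\<close>

lemma normalized_mellin_extend_halfplane:
  assumes N: "finite N"
  shows "amplitude N \<Phi> \<Longrightarrow> \<forall>j\<in>N. 0 \<le> b j \<Longrightarrow> \<forall>j\<in>N. \<forall>h>c. -1 < a j + b j * h \<Longrightarrow>
    \<forall>j\<in>N. -1 < a j + real (d j) + b j * \<sigma> \<Longrightarrow>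
    \<exists>E. E holomorphic_on {H. \<sigma> < Re H} \<and> (\<forall>H. c < Re H \<longrightarrow> E H = normalized_mellin N a b \<Phi> H)"
proof (induction "sum d N" arbitrary: a b \<Phi> d rule: less_induct)
  case less
  show ?case
  proof (cases "\<forall>j\<in>N. d j = 0")
    case True
    then have "mellin N a b \<Phi> holomorphic_on {H. \<sigma> < Re H}"
      using less.prems by (intro mellin_holomorphic N) auto
    then have "normalized_mellin N a b \<Phi> holomorphic_on {H. \<sigma> < Re H}"
      unfolding normalized_mellin_def[abs_def] by (intro holomorphic_intros)
    then show ?thesis by blast
  next
    case False
    then obtain j where j: "j \<in> N" "0 < d j" by auto
    obtain \<Phi>' where \<Phi>': "amplitude N \<Phi>'"
      and der: "\<And>x H. \<forall>i\<in>N. 0 \<le> x i \<Longrightarrow> ((\<lambda>t. \<Phi> (x(j := t)) H) has_vector_derivative \<Phi>' x H) (at (x j))"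
      using amplitude_derivative[OF less.prems(1), of j] by blast
    have \<Phi>1: "amplitude N (\<lambda>x. \<Phi> (x(j := 1)))"
    proof (rule amplitude_subst[OF less.prems(1)])
      fix i assume "i \<in> N"
      then show "coord_poly N (\<lambda>x. (x(j := 1)) i)"
        by (cases "i = j") (auto intro: coord_poly.intros)
    qed
    \<comment> \<open>The boundary term has exponent 0 in \<open>j\<close> and needs no further step
      there; the derivative term has its exponent raised by one and needs one step fewer. Both lower
      the induction measure.\<close>
    have d1: "sum (d(j := 0)) N < sum d N" and d2: "sum (d(j := d j - 1)) N < sum d N"
      using j N by (auto intro!: sum_strict_mono2 simp: sum.remove[OF N j(1)] cong: sum.cong_simp)
    have "\<exists>E. E holomorphic_on {H. \<sigma> < Re H} \<and> (\<forall>H. c < Re H \<longrightarrow>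
        E H = normalized_mellin N (a(j := 0)) (b(j := 0)) (\<lambda>x. \<Phi> (x(j := 1))) H)"
      by (rule less.hyps[OF d1 \<Phi>1]) (use less.prems in auto)
    then obtain E1 where E1: "E1 holomorphic_on {H. \<sigma> < Re H}"
      "\<And>H. c < Re H \<Longrightarrow> E1 H = normalized_mellin N (a(j := 0)) (b(j := 0)) (\<lambda>x. \<Phi> (x(j := 1))) H"
      by blast
    have "-1 < a j + 1 + b j * h" if "c < h" for h
      using less.prems(3) j(1) that by (smt (verit, best))
    then have ab2: "\<forall>i\<in>N. \<forall>h>c. -1 < (a(j := a j + 1)) i + b i * h"
      using less.prems(3) by auto
    have "\<exists>E. E holomorphic_on {H. \<sigma> < Re H} \<and> (\<forall>H. c < Re H \<longrightarrow>
        E H = normalized_mellin N (a(j := a j + 1)) b \<Phi>' H)"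
      by (rule less.hyps[OF d2 \<Phi>' less.prems(2) ab2]) (use less.prems(4) j in \<open>auto simp: of_nat_diff\<close>)
    then obtain E2 where E2: "E2 holomorphic_on {H. \<sigma> < Re H}"
      "\<And>H. c < Re H \<Longrightarrow> E2 H = normalized_mellin N (a(j := a j + 1)) b \<Phi>' H"
      by blast
    have "(\<lambda>H. rGamma (of_real (a j) + of_real (b j) * H + 2) * E1 H - E2 H) holomorphic_on {H. \<sigma> < Re H}"
      using E1(1) E2(1) by (intro holomorphic_intros)
    moreover have "rGamma (of_real (a j) + of_real (b j) * H + 2) * E1 H - E2 H = normalized_mellin N a b \<Phi> H"
      if "c < Re H" for H
      unfolding E1(2)[OF that] E2(2)[OF that]
      by (rule normalized_mellin_recursion[OF N j(1) less.prems(1) \<Phi>' der less.prems(2), symmetric])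
        (use less.prems(3) that in auto)
    ultimately show ?thesis by blast
  qed
qed

text \<open>Any two of the half-planes share a part of \<open>Re H > c\<close>, where both
  extensions equal \<open>f\<close>. The smaller half-plane is connected, so the identity theorem
  makes them agree on all of it.\<close>

lemma entire_extension_glue:
  assumes "\<And>n::nat. \<exists>E. E holomorphic_on {H. - real n < Re H} \<and> (\<forall>H. c < Re H \<longrightarrow> E H = f H)"
  shows "\<exists>E. E holomorphic_on UNIV \<and> (\<forall>H. c < Re H \<longrightarrow> E H = f H)"
proof -
  let ?A = "\<lambda>n::nat. {H. - real n < Re H}"
  obtain E where E: "\<And>n. E n holomorphic_on ?A n" "\<And>n H. c < Re H \<Longrightarrow> E n H = f H"
    using assms by metis
  have agree: "E n H = E m H" if "n \<le> m" "H \<in> ?A n" for n m H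
  proof (rule analytic_continuation_open[where f = "E n" and g = "E m" and s = "{H. max c (- real n) < Re H}" and s' = "?A n"])
    have "complex_of_real (max c (- real n) + 1) \<in> {H. max c (- real n) < Re H}"
      using max.cobounded1[of c "- real n"] max.cobounded2[of "- real n" c] by simp linarith
    then show "{H. max c (- real n) < Re H} \<noteq> {}" by blast
    show "open {H. max c (- real n) < Re H}" by (rule open_halfspace_Re_gt)
    show "connected (?A n)" by (intro convex_connected convex_halfspace_Re_gt)
    show "E n holomorphic_on ?A n" by (rule E)
    show "E m holomorphic_on ?A n"
      by (rule holomorphic_on_subset[OF E(1)[of m]]) (use that in auto)
  qed (use E(2) that in \<open>auto intro: open_halfspace_Re_gt\<close>)
  \<comment> \<open>The index is chosen so that \<open>H\<close> itself lies in the corresponding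
    half-plane.\<close>
  define F where "F H = E (Suc (nat \<lceil>\<bar>Re H\<bar>\<rceil>)) H" for H
  have FE: "F H = E n H" if "H \<in> ?A n" for n H
  proof -
    have "H \<in> ?A (Suc (nat \<lceil>\<bar>Re H\<bar>\<rceil>))" by simp linarith
    then show ?thesis using agree that unfolding F_def by (metis nat_le_linear)
  qed
  have "F holomorphic_on (\<Union>n\<in>UNIV. ?A n)"
  proof (rule holomorphic_on_UN_open)
    show "F holomorphic_on ?A n" for n
      by (rule holomorphic_transform[OF E(1)]) (simp add: FE)
  qed (rule open_halfspace_Re_gt)
  moreover have "(\<Union>n\<in>UNIV. ?A n) = UNIV"
  proof -
    have "\<exists>n::nat. - real n < Re H" for H
      using reals_Archimedean2[of "- Re H"] by (auto simp: minus_less_iff)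
    then show ?thesis by auto
  qed
  moreover have "F H = f H" if "c < Re H" for H
    unfolding F_def using E(2)[OF that] .
  ultimately show ?thesis by metis
qed

text \<open>The continuation is an entire function divided by a product of \<open>rGamma\<close>
  factors, and \<open>rGamma\<close> vanishes exactly at the nonpositive integers.\<close>

lemma mellin_meromorphic_continuation:
  assumes N: "finite N" and \<Phi>: "amplitude N \<Phi>" and b: "\<forall>j\<in>N. 0 \<le> b j"
    and ab: "\<forall>j\<in>N. \<forall>h>c. -1 < a j + b j * h"
  shows "\<exists>F. F meromorphic_on UNIV \<and> (\<forall>H. c < Re H \<longrightarrow> F H = mellin N a b \<Phi> H) \<and>
    F holomorphic_on {H. \<forall>j\<in>N. of_real (a j) + of_real (b j) * H + 1 \<notin> \<int>\<^sub>\<le>\<^sub>0}"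
proof -
  let ?G = "\<lambda>H::complex. \<Prod>j\<in>N. rGamma (of_real (a j) + of_real (b j) * H + 1)"
  have "\<exists>E. E holomorphic_on {H. - real n < Re H} \<and> (\<forall>H. c < Re H \<longrightarrow> E H = normalized_mellin N a b \<Phi> H)" for n
  proof (rule normalized_mellin_extend_halfplane[OF N \<Phi> b ab])
    \<comment> \<open>With \<open>b j * n - a j\<close> rounded up as the number of steps, the
      exponent at \<open>Re H = - n\<close> is even nonnegative.\<close>
    show "\<forall>j\<in>N. -1 < a j + real (nat \<lceil>b j * real n - a j\<rceil>) + b j * - real n" by (intro ballI) linarith
  qed
  then obtain E where E: "E holomorphic_on UNIV" "\<And>H. c < Re H \<Longrightarrow> E H = normalized_mellin N a b \<Phi> H"
    using entire_extension_glue[of c "normalized_mellin N a b \<Phi>"] by blast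
  have G: "?G holomorphic_on A" for A by (intro holomorphic_intros)
  have "(\<lambda>H. E H / ?G H) meromorphic_on UNIV"
    using E(1) G by (intro meromorphic_on_divide analytic_on_imp_meromorphic_on) (auto simp: analytic_on_open)
  moreover have "E H / ?G H = mellin N a b \<Phi> H" if "c < Re H" for H
  \<comment> \<open>For \<open>Re H > c\<close> every argument of \<open>rGamma\<close> has positive
    real part, so the quotient there undoes the normalization.\<close>
  proof -
    have "of_real (a j) + of_real (b j) * H + 1 \<notin> \<int>\<^sub>\<le>\<^sub>0" if "j \<in> N" for j
    proof
      assume "of_real (a j) + of_real (b j) * H + 1 \<in> \<int>\<^sub>\<le>\<^sub>0"
      then obtain n where n: "of_real (a j) + of_real (b j) * H + 1 = complex_of_int n" "n \<le> 0"
        by (auto elim: nonpos_Ints_cases)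
      from arg_cong[OF n(1), of Re] have "a j + b j * Re H + 1 \<le> 0" using n(2) by simp
      moreover have "-1 < a j + b j * Re H" using ab \<open>j \<in> N\<close> \<open>c < Re H\<close> by blast
      ultimately show False by linarith
    qed
    then have "?G H \<noteq> 0" using N by (auto simp: rGamma_eq_zero_iff)
    then show ?thesis by (simp add: E(2)[OF that] normalized_mellin_def)
  qed
  moreover have "(\<lambda>H. E H / ?G H) holomorphic_on {H. \<forall>j\<in>N. of_real (a j) + of_real (b j) * H + 1 \<notin> \<int>\<^sub>\<le>\<^sub>0}"
    using E(1) G N
    by (intro holomorphic_on_divide) (auto intro: holomorphic_on_subset simp: rGamma_eq_zero_iff)
  ultimately show ?thesis by (intro exI[of _ "\<lambda>H. E H / ?G H"]) auto
qed

section \<open>Sector decomposition\<close>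

text \<open>What the decomposition needs to know of a pair partition: \<open>Q l\<close> will be the
  set of gaps of block \<open>l\<close>. The last assumption gives convergence for
  \<open>Re H > 1/2\<close>.\<close>

locale subset_family =
  fixes N :: "nat set" and L :: "nat set" and Q :: "nat \<Rightarrow> nat set"
  assumes finite_N: "finite N" and finite_L: "finite L"
    and Q_subset: "l \<in> L \<Longrightarrow> Q l \<subseteq> N" and Q_nonempty: "l \<in> L \<Longrightarrow> Q l \<noteq> {}"
    and card_inside_le: "S \<subseteq> N \<Longrightarrow> card {l \<in> L. Q l \<subseteq> S} \<le> card S"
begin

definition inside :: "nat set \<Rightarrow> nat set" where
  "inside S = {l \<in> L. Q l \<subseteq> S}"

text \<open>The total exponent of the dominant coordinate, arranged as a real constant plus a real
  multiple of \<open>H\<close> to fit \<open>mellin_integrand\<close>.\<close>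

definition exponent :: "nat set \<Rightarrow> complex \<Rightarrow> complex" where
  "exponent S H = of_real (real (card S) - 1 - 2 * real (card (inside S)))
     + of_real (2 * real (card (inside S))) * H"

text \<open>The excluded points refer to all nonempty \<open>S\<close>, not just to those met in one
  sector, so finite sums over sectors keep the property.\<close>

definition continuable :: "(complex \<Rightarrow> complex) \<Rightarrow> bool" where
  "continuable f \<longleftrightarrow> (\<exists>F. F meromorphic_on UNIV \<and> (\<forall>H. 1/2 < Re H \<longrightarrow> F H = f H) \<and>
     F holomorphic_on {H. \<forall>S\<subseteq>N. S \<noteq> {} \<longrightarrow> exponent S H + 1 \<notin> \<int>\<^sub>\<le>\<^sub>0})"

text \<open>The coordinates in \<open>T\<close> are not yet blown up; \<open>\<sigma> j\<close> is the set of coordinates in play when \<open>j\<close> was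
  chosen as the dominant one.\<close>

definition sector_integrand ::
    "nat set \<Rightarrow> (nat \<Rightarrow> nat set) \<Rightarrow> ((nat \<Rightarrow> real) \<Rightarrow> complex \<Rightarrow> complex) \<Rightarrow>
     complex \<Rightarrow> (nat \<Rightarrow> real) \<Rightarrow> complex" where
  "sector_integrand T \<sigma> \<Phi> H x = indicat_real (open_cube N) x *\<^sub>R
     ((\<Prod>j\<in>N - T. complex_of_real (x j) powr exponent (\<sigma> j) H) *
      (\<Prod>l\<in>inside T. complex_of_real (\<Sum>i\<in>Q l. x i) powr (-2 + 2 * H)) * \<Phi> x H)"

lemma continuable_sum:
  assumes "\<And>m. m \<in> A \<Longrightarrow> continuable (f m)"
  shows "continuable (\<lambda>H. \<Sum>m\<in>A. f m H)"
proof -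
  have "\<forall>m\<in>A. \<exists>F. F meromorphic_on UNIV \<and> (\<forall>H. 1/2 < Re H \<longrightarrow> F H = f m H) \<and>
     F holomorphic_on {H. \<forall>S\<subseteq>N. S \<noteq> {} \<longrightarrow> exponent S H + 1 \<notin> \<int>\<^sub>\<le>\<^sub>0}"
    using assms unfolding continuable_def by (rule ballI)
  from bchoice[OF this] obtain F where F: "\<forall>m\<in>A. F m meromorphic_on UNIV \<and>
      (\<forall>H. 1/2 < Re H \<longrightarrow> F m H = f m H) \<and>
      F m holomorphic_on {H. \<forall>S\<subseteq>N. S \<noteq> {} \<longrightarrow> exponent S H + 1 \<notin> \<int>\<^sub>\<le>\<^sub>0}"
    by (rule exE)
  then show ?thesis unfolding continuable_def
    by (intro exI[of _ "\<lambda>H. \<Sum>m\<in>A. F m H"] conjI)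
      (auto intro!: meromorphic_on_sum holomorphic_on_sum sum.cong)
qed

lemma continuable_cong:
  assumes "continuable g" "\<And>H. 1/2 < Re H \<Longrightarrow> f H = g H"
  shows "continuable f"
  using assms unfolding continuable_def by auto

text \<open>Origin of the threshold 1/2. If \<open>p\<close> blocks lie inside \<open>S\<close> and
  \<open>p > 0\<close>, then \<open>|S| - 2p + 2ph > |S| - p >= 0\<close>; if \<open>p = 0\<close>,
  the left side is \<open>|S| > 0\<close>.\<close>

lemma exponent_gt:
  assumes "S \<subseteq> N" "S \<noteq> {}" "1/2 < h"
  shows "-1 < (real (card S) - 1 - 2 * real (card (inside S))) + 2 * real (card (inside S)) * h"
proof -
  let ?p = "real (card (inside S))"
  have "finite S" using assms finite_N finite_subset by blast
  then have S: "0 < real (card S)" using assms by (simp add: card_gt_0_iff)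
  have pS: "?p \<le> real (card S)" using card_inside_le[OF assms(1)] by (simp add: inside_def)
  show ?thesis
  proof (cases "?p = 0")
    case True
    then show ?thesis using S by (simp only: True)
  next
    case False
    then have "?p * 1 < ?p * (2 * h)" using assms(3) by (intro mult_strict_left_mono) auto
    then show ?thesis using pS by (simp add: algebra_simps)
  qed
qed

text \<open>Every block inside \<open>T\<close> yields one factor \<open>r powr w\<close>. If it
  contains \<open>m\<close>, dividing its sum by \<open>r\<close> leaves 1 plus nonnegative terms;
  otherwise the same kind of sum remains, over a subset of \<open>T - {m}\<close>.\<close>

lemma pair_product_scaled:
  assumes m: "m \<in> T" "T \<subseteq> N" and r: "0 < r" and x: "\<And>i. i \<in> T - {m} \<Longrightarrow> 0 < x i"
    and z: "z m = r" "\<And>i. i \<in> T - {m} \<Longrightarrow> z i = r * x i"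
  shows "(\<Prod>l\<in>inside T. complex_of_real (\<Sum>i\<in>Q l. z i) powr w) =
    complex_of_real r powr (of_nat (card (inside T)) * w) *
    (\<Prod>l\<in>inside (T - {m}). complex_of_real (\<Sum>i\<in>Q l. x i) powr w) *
    (\<Prod>l\<in>{l\<in>inside T. m \<in> Q l}. complex_of_real (1 + (\<Sum>i\<in>Q l - {m}. x i)) powr w)"
proof -
  let ?A = "inside (T - {m})" and ?B = "{l\<in>inside T. m \<in> Q l}"
  have fin: "finite (inside T)" using finite_L by (simp add: inside_def)
  have AB: "inside T = ?A \<union> ?B" "?A \<inter> ?B = {}" by (auto simp: inside_def)
  have finAB: "finite ?A" "finite ?B" using finite_L by (simp_all add: inside_def)
  have finQ: "finite (Q l)" if "l \<in> inside T" for l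
    using that Q_subset finite_N finite_subset by (fastforce simp: inside_def)
  have A: "complex_of_real (\<Sum>i\<in>Q l. z i) powr w
      = complex_of_real r powr w * complex_of_real (\<Sum>i\<in>Q l. x i) powr w" if l: "l \<in> ?A" for l
  proof -
    have sub: "Q l \<subseteq> T - {m}" using l by (simp add: inside_def)
    then have "(\<Sum>i\<in>Q l. z i) = r * (\<Sum>i\<in>Q l. x i)"
      using z(2) by (auto simp: sum_distrib_left intro!: sum.cong)
    moreover have "0 \<le> (\<Sum>i\<in>Q l. x i)" using sub x by (intro sum_nonneg) (auto intro: less_imp_le)
    ultimately show ?thesis using r by (simp only: of_real_mult) (rule powr_times_real, auto)
  qed
  have B: "complex_of_real (\<Sum>i\<in>Q l. z i) powr w
      = complex_of_real r powr w * complex_of_real (1 + (\<Sum>i\<in>Q l - {m}. x i)) powr w" if l: "l \<in> ?B" for l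
  proof -
    have sub: "Q l - {m} \<subseteq> T - {m}" "m \<in> Q l" using l by (auto simp: inside_def)
    have "(\<Sum>i\<in>Q l. z i) = z m + (\<Sum>i\<in>Q l - {m}. z i)"
      using l sub finQ[of l] by (intro sum.remove) auto
    also have "(\<Sum>i\<in>Q l - {m}. z i) = r * (\<Sum>i\<in>Q l - {m}. x i)"
      unfolding sum_distrib_left using sub z(2) by (intro sum.cong) auto
    finally have "(\<Sum>i\<in>Q l. z i) = r * (1 + (\<Sum>i\<in>Q l - {m}. x i))"
      using z(1) by (simp add: algebra_simps)
    moreover have "0 \<le> (\<Sum>i\<in>Q l - {m}. x i)" using sub x by (intro sum_nonneg) (auto intro: less_imp_le)
    ultimately show ?thesis using r by (simp only: of_real_mult) (rule powr_times_real, auto)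
  qed
  have "(\<Prod>l\<in>inside T. complex_of_real (\<Sum>i\<in>Q l. z i) powr w)
    = (\<Prod>l\<in>?A. complex_of_real (\<Sum>i\<in>Q l. z i) powr w) * (\<Prod>l\<in>?B. complex_of_real (\<Sum>i\<in>Q l. z i) powr w)"
    by (subst AB(1)) (rule prod.union_disjoint[OF finAB AB(2)])
  also have "(\<Prod>l\<in>?A. complex_of_real (\<Sum>i\<in>Q l. z i) powr w)
      = (complex_of_real r powr w) ^ card ?A * (\<Prod>l\<in>?A. complex_of_real (\<Sum>i\<in>Q l. x i) powr w)"
    using A by (simp add: prod.distrib)
  also have "(\<Prod>l\<in>?B. complex_of_real (\<Sum>i\<in>Q l. z i) powr w)
      = (complex_of_real r powr w) ^ card ?B *
        (\<Prod>l\<in>?B. complex_of_real (1 + (\<Sum>i\<in>Q l - {m}. x i)) powr w)"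
    using B by (simp add: prod.distrib)
  finally have prod_eq: "(\<Prod>l\<in>inside T. complex_of_real (\<Sum>i\<in>Q l. z i) powr w)
      = (complex_of_real r powr w) ^ card ?A * (\<Prod>l\<in>?A. complex_of_real (\<Sum>i\<in>Q l. x i) powr w) *
        ((complex_of_real r powr w) ^ card ?B *
        (\<Prod>l\<in>?B. complex_of_real (1 + (\<Sum>i\<in>Q l - {m}. x i)) powr w))" .
  have pow: "complex_of_real r powr (of_nat (card (inside T)) * w)
      = (complex_of_real r powr w) ^ card ?A * (complex_of_real r powr w) ^ card ?B"
  proof -
    have "card (inside T) = card ?A + card ?B"
      using AB finAB by (metis card_Un_disjoint)
    then show ?thesis using r
      by (simp add: powr_def exp_of_nat_mult exp_add distrib_right mult.assoc)
  qed
  show ?thesis unfolding prod_eq pow by (simp only: mult_ac)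
qed

text \<open>Separates the Jacobian of scaling the other \<open>card S - 1\<close> coordinates from
  the powers pulled out of the blocks inside \<open>S\<close>.\<close>

lemma powr_exponent:
  assumes "S \<noteq> {}" "S \<subseteq> N" "0 < r"
  shows "complex_of_real r powr exponent S H
    = complex_of_real r ^ (card S - 1) * complex_of_real r powr (of_nat (card (inside S)) * (-2 + 2 * H))"
proof -
  have "finite S" using assms finite_N finite_subset by blast
  then have "1 \<le> card S" using assms(1) by (simp add: Suc_leI card_gt_0_iff)
  then have "exponent S H = of_nat (card S - 1) + of_nat (card (inside S)) * (-2 + 2 * H)"
    by (simp add: exponent_def of_nat_diff algebra_simps)
  then show ?thesis using assms(3) by (simp add: powr_add)
qed

text \<open>Blocks inside \<open>T\<close> that contain \<open>m\<close> become regular at this step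
  and move into the amplitude. The substitution is \<open>coord_scale\<close> without its case
  distinction: it agrees with it for \<open>x m > 0\<close> and is polynomial, as
  \<open>amplitude_subst\<close> requires.\<close>

definition blown_up :: "nat set \<Rightarrow> nat \<Rightarrow> ((nat \<Rightarrow> real) \<Rightarrow> complex \<Rightarrow> complex) \<Rightarrow>
     (nat \<Rightarrow> real) \<Rightarrow> complex \<Rightarrow> complex" where
  "blown_up T m \<Phi> x H = \<Phi> (\<lambda>i. if i \<in> T - {m} then x m * x i else x i) H *
     (\<Prod>l\<in>{l\<in>inside T. m \<in> Q l}. complex_of_real (1 + (\<Sum>i\<in>Q l - {m}. x i)) powr (-2 + 2 * H))"

lemma amplitude_coord_sum_powr:
  assumes "A \<subseteq> N"
  shows "amplitude N (\<lambda>x H. complex_of_real (1 + (\<Sum>i\<in>A. x i)) powr (u + v * H))"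
  using assms finite_subset[OF assms finite_N]
  by (intro amplitude_powr coord_poly_sum coord_poly_coord) auto

lemma amplitude_blown_up:
  assumes "amplitude N \<Phi>" "m \<in> T" "T \<subseteq> N"
  shows "amplitude N (blown_up T m \<Phi>)"
proof -
  have 1: "amplitude N (\<lambda>x H. \<Phi> (\<lambda>i. if i \<in> T - {m} then x m * x i else x i) H)"
  proof (rule amplitude_subst[OF assms(1)])
    fix i assume i: "i \<in> N"
    have "m \<in> N" using assms by blast
    then show "coord_poly N (\<lambda>x. if i \<in> T - {m} then x m * x i else x i)"
      using i by (cases "i \<in> T - {m}") (auto intro: coord_poly.intros)
  qed
  have 2: "amplitude N (\<lambda>x H. \<Prod>l\<in>{l\<in>inside T. m \<in> Q l}.
      complex_of_real (1 + (\<Sum>i\<in>Q l - {m}. x i)) powr (-2 + 2 * H))"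
  proof (rule amplitude_prod)
    show "finite {l\<in>inside T. m \<in> Q l}" using finite_L by (simp add: inside_def)
    fix l assume "l \<in> {l\<in>inside T. m \<in> Q l}"
    then have "Q l - {m} \<subseteq> N" using Q_subset[of l] by (auto simp: inside_def)
    then show "amplitude N (\<lambda>x H. complex_of_real (1 + (\<Sum>i\<in>Q l - {m}. x i)) powr (-2 + 2 * H))"
      by (rule amplitude_coord_sum_powr)
  qed
  show ?thesis using amplitude_mult[OF 1 2] unfolding blown_up_def[abs_def] .
qed

text \<open>One blow-up as a pointwise identity. Dominance of \<open>x m\<close> after scaling says
  that the other coordinates in \<open>T\<close> were below 1, so the domain is again the whole cube
  and the decomposition can be iterated.\<close>

lemma sector_integrand_blown_up:
  assumes m: "m \<in> T" "T \<subseteq> N"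
  shows "(if 0 < x m then x m else 1) ^ card (T - {m}) *\<^sub>R
      indicat_real (dominant T m) (coord_scale (T - {m}) m x) *\<^sub>R
      sector_integrand T \<sigma> \<Phi> H (coord_scale (T - {m}) m x)
    = sector_integrand (T - {m}) (\<sigma>(m := T)) (blown_up T m \<Phi>) H x"
proof -
  let ?z = "coord_scale (T - {m}) m x"
  have zm: "?z m = x m" by (simp add: coord_scale_def)
  have mN: "m \<in> N" using m by blast
  show ?thesis
  proof (cases "0 < x m \<and> x m < 1")
    \<comment> \<open>Scaling fixes coordinate \<open>m\<close>, so both points are outside the cube
      and both sides vanish, whichever branch \<open>coord_scale\<close> takes.\<close>
    case False
    then have "?z \<notin> open_cube N" "x \<notin> open_cube N"
      using mN zm unfolding open_cube_def mem_Collect_eq by (metis, metis)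
    then show ?thesis by (simp add: sector_integrand_def)
  next
    case True
    then have xm: "0 < x m" "x m < 1" by auto
    have z1: "?z i = x m * x i" if "i \<in> T - {m}" for i using that xm by (simp add: coord_scale_def)
    have z2: "?z i = x i" if "i \<notin> T - {m}" for i
      using that unfolding coord_scale_def by (rule if_not_P)
    have z3: "?z = (\<lambda>i. if i \<in> T - {m} then x m * x i else x i)"
      using xm(1) by (auto simp: coord_scale_def fun_eq_iff)
    have cube: "?z \<in> open_cube N \<and> ?z \<in> dominant T m \<longleftrightarrow> x \<in> open_cube N"
    proof
      assume a: "?z \<in> open_cube N \<and> ?z \<in> dominant T m"
      have "0 < x i \<and> x i < 1" if "i \<in> N" for i
      proof (cases "i \<in> T - {m}")
        case True
        have "0 < ?z i" "?z i < ?z m" using a that True by (auto simp: open_cube_def dominant_def)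
        then have "0 < x m * x i" "x m * x i < x m" unfolding z1[OF True] zm .
        then show ?thesis using xm by (simp add: zero_less_mult_iff)
      next
        case False
        have "0 < ?z i \<and> ?z i < 1" using a that unfolding open_cube_def by blast
        then show ?thesis by (simp only: z2[OF False])
      qed
      then show "x \<in> open_cube N" by (simp add: open_cube_def)
    next
      assume x: "x \<in> open_cube N"
      have "0 < x m * x i" "x m * x i < x m" if "i \<in> T - {m}" for i
        using x that m xm by (auto simp: open_cube_def)
      then have "0 < ?z i" "?z i < x m" if "i \<in> T - {m}" for i using z1 that by auto
      then have "0 < ?z i \<and> ?z i < 1" if "i \<in> N" for i
        using that xm x z2 by (cases "i \<in> T - {m}") (force simp: open_cube_def)+
      moreover have "?z \<in> dominant T m" using \<open>\<And>i. i \<in> T - {m} \<Longrightarrow> ?z i < x m\<close> zm by (simp add: dominant_def)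
      ultimately show "?z \<in> open_cube N \<and> ?z \<in> dominant T m" by (simp add: open_cube_def)
    qed
    show ?thesis
    proof (cases "x \<in> open_cube N")
      case False
      then have "indicat_real (dominant T m) ?z * indicat_real (open_cube N) ?z = 0"
        using cube by (auto simp: indicator_def)
      then show ?thesis using False by (auto simp: sector_integrand_def)
    next
      case x: True
      have "N - (T - {m}) = insert m (N - T)" using m by auto
      then have P1: "(\<Prod>j\<in>N - (T - {m}). complex_of_real (x j) powr exponent ((\<sigma>(m := T)) j) H)
          = complex_of_real (x m) powr exponent T H * (\<Prod>j\<in>N - T. complex_of_real (x j) powr exponent (\<sigma> j) H)"
        using finite_N m by (auto intro!: arg_cong2[where f = "(*)"] prod.cong)
      have P2: "(\<Prod>j\<in>N - T. complex_of_real (?z j) powr exponent (\<sigma> j) H)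
          = (\<Prod>j\<in>N - T. complex_of_real (x j) powr exponent (\<sigma> j) H)"
        by (intro prod.cong refl) (simp add: coord_scale_def)
      have P3: "(\<Prod>l\<in>inside T. complex_of_real (\<Sum>i\<in>Q l. ?z i) powr (-2 + 2 * H)) =
        complex_of_real (x m) powr (of_nat (card (inside T)) * (-2 + 2 * H)) *
        (\<Prod>l\<in>inside (T - {m}). complex_of_real (\<Sum>i\<in>Q l. x i) powr (-2 + 2 * H)) *
        (\<Prod>l\<in>{l\<in>inside T. m \<in> Q l}. complex_of_real (1 + (\<Sum>i\<in>Q l - {m}. x i)) powr (-2 + 2 * H))"
        by (rule pair_product_scaled[OF m xm(1)]) (use x z1 zm m in \<open>auto simp: open_cube_def\<close>)
      have P4: "complex_of_real (x m) powr exponent T H = complex_of_real (x m) ^ card (T - {m}) *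
          complex_of_real (x m) powr (of_nat (card (inside T)) * (-2 + 2 * H))"
        using powr_exponent[OF _ m(2) xm(1)] m by auto
      show ?thesis
        unfolding sector_integrand_def P1 P2 P3 P4 blown_up_def z3[symmetric]
        using cube x xm by (simp add: scaleR_conv_of_real)
    qed
  qed
qed

lemma sector_integrand_measurable:
  assumes "amplitude N \<Phi>" "T \<subseteq> N"
  shows "sector_integrand T \<sigma> \<Phi> H \<in> borel_measurable (lebesgue_on_coords N)"
proof -
  note [measurable] = amplitude_measurable[OF assms(1), of H] measurable_coord
  have [measurable]: "indicat_real (open_cube N) \<in> borel_measurable (lebesgue_on_coords N)"
    unfolding indicator_open_cube[OF finite_N, abs_def] by measurable
  have 1: "(\<lambda>x. complex_of_real (\<Sum>i\<in>Q l. x i) powr (-2 + 2 * H)) \<in> borel_measurable (lebesgue_on_coords N)"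
    if "l \<in> inside T" for l
  proof -
    have [measurable]: "(\<lambda>x. \<Sum>i\<in>Q l. x i) \<in> borel_measurable (lebesgue_on_coords N)"
      using that assms(2) by (intro borel_measurable_sum measurable_coord) (auto simp: inside_def)
    show ?thesis unfolding powr_def by measurable
  qed
  have 2: "(\<lambda>x. complex_of_real (x j) powr exponent (\<sigma> j) H) \<in> borel_measurable (lebesgue_on_coords N)"
    if "j \<in> N - T" for j
  proof -
    have [measurable]: "(\<lambda>x. x j) \<in> borel_measurable (lebesgue_on_coords N)"
      using that by (intro measurable_coord) auto
    show ?thesis unfolding powr_def by measurable
  qed
  show ?thesis unfolding sector_integrand_def[abs_def]
    by (intro borel_measurable_scaleR borel_measurable_times borel_measurable_prod 1 2) measurable
qed

text \<open>Each choice of a dominant \<open>m\<close> in \<open>T\<close> removes one coordinate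
  from play, so the induction ends in Mellin integrals. Integrability is carried along because
  splitting the integral at the next stage requires it.\<close>

lemma sector_integral_continuable:
  assumes "T \<subseteq> N" "amplitude N \<Phi>" "\<forall>j\<in>N - T. \<sigma> j \<subseteq> N \<and> \<sigma> j \<noteq> {}"
  shows "(\<forall>H. 1/2 < Re H \<longrightarrow> integrable (lebesgue_on_coords N) (sector_integrand T \<sigma> \<Phi> H)) \<and>
    continuable (\<lambda>H. \<integral>x. sector_integrand T \<sigma> \<Phi> H x \<partial>lebesgue_on_coords N)"
  using assms
proof (induction "card T" arbitrary: T \<sigma> \<Phi>)
  case 0
  then have T: "T = {}" using finite_N finite_subset by fastforce
  let ?a = "\<lambda>j. real (card (\<sigma> j)) - 1 - 2 * real (card (inside (\<sigma> j)))"
    and ?b = "\<lambda>j. 2 * real (card (inside (\<sigma> j)))"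
  have e: "of_real (?a j) + of_real (?b j) * H = exponent (\<sigma> j) H" for j H
    by (simp only: exponent_def)
  \<comment> \<open>As no \<open>Q l\<close> is empty, no unresolved sum is left once
    \<open>T\<close> is empty.\<close>
  have "inside {} = {}" using Q_nonempty by (auto simp: inside_def)
  then have f: "sector_integrand T \<sigma> \<Phi> = mellin_integrand N ?a ?b \<Phi>"
    unfolding sector_integrand_def[abs_def] mellin_integrand_def[abs_def] e T by simp
  have b: "\<forall>j\<in>N. 0 \<le> ?b j" by simp
  have ab: "\<forall>j\<in>N. \<forall>h>1/2. -1 < ?a j + ?b j * h"
    using exponent_gt 0 T by auto
  obtain F where F: "F meromorphic_on UNIV" "\<forall>H. 1/2 < Re H \<longrightarrow> F H = mellin N ?a ?b \<Phi> H"
    "F holomorphic_on {H. \<forall>j\<in>N. of_real (?a j) + of_real (?b j) * H + 1 \<notin> \<int>\<^sub>\<le>\<^sub>0}"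
    using mellin_meromorphic_continuation[OF finite_N 0(3) b ab] by blast
  have "F holomorphic_on {H. \<forall>S\<subseteq>N. S \<noteq> {} \<longrightarrow> exponent S H + 1 \<notin> \<int>\<^sub>\<le>\<^sub>0}"
    by (rule holomorphic_on_subset[OF F(3)]) (use 0(4) T in \<open>unfold e, auto\<close>)
  then have "continuable (\<lambda>H. \<integral>x. sector_integrand T \<sigma> \<Phi> H x \<partial>lebesgue_on_coords N)"
    unfolding continuable_def f mellin_def[symmetric] using F by blast
  moreover have "integrable (lebesgue_on_coords N) (sector_integrand T \<sigma> \<Phi> H)" if "1/2 < Re H" for H
    unfolding f by (rule mellin_integrable[OF finite_N 0(3) b]) (use ab that in blast)
  ultimately show ?case by blast
next
  case (Suc n)
  have T: "T \<noteq> {}" "finite T" using Suc(2) by (auto simp: card_eq_0_iff intro: card_ge_0_finite)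
  let ?\<psi> = "\<lambda>m. coord_scale (T - {m}) m"
    and ?J = "\<lambda>m x::nat \<Rightarrow> real. (if 0 < x m then x m else 1) ^ card (T - {m})"
    and ?g = "\<lambda>m. sector_integrand (T - {m}) (\<sigma>(m := T)) (blown_up T m \<Phi>)"
  have IH: "(\<forall>H. 1/2 < Re H \<longrightarrow> integrable (lebesgue_on_coords N) (?g m H)) \<and>
      continuable (\<lambda>H. \<integral>x. ?g m H x \<partial>lebesgue_on_coords N)" if m: "m \<in> T" for m
  proof (rule Suc(1))
    show "n = card (T - {m})" using Suc(2) m T by simp
    show "amplitude N (blown_up T m \<Phi>)" using Suc m by (intro amplitude_blown_up) auto
  qed (use Suc T m in auto)
  have cov: "change_of_variables (lebesgue_on_coords N) (?\<psi> m) (?J m)" if "m \<in> T" for m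
    using that Suc by (intro change_of_variables_coord_scale finite_N) auto
  have eq: "?J m x *\<^sub>R indicat_real (dominant T m) (?\<psi> m x) *\<^sub>R sector_integrand T \<sigma> \<Phi> H (?\<psi> m x) = ?g m H x"
    if "m \<in> T" for m H x
    using sector_integrand_blown_up[OF that Suc(3)] .
  have meas: "sector_integrand T \<sigma> \<Phi> H \<in> borel_measurable (lebesgue_on_coords N)" for H
    using Suc by (intro sector_integrand_measurable)
  have int: "integrable (lebesgue_on_coords N) (\<lambda>x. ?J m x *\<^sub>R indicat_real (dominant T m) (?\<psi> m x) *\<^sub>R
      sector_integrand T \<sigma> \<Phi> H (?\<psi> m x))" if "m \<in> T" "1/2 < Re H" for m H
    unfolding eq[OF that(1)] using IH that by blast
  have 1: "integrable (lebesgue_on_coords N) (sector_integrand T \<sigma> \<Phi> H)" if "1/2 < Re H" for H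
    by (rule integral_split_dominant(1)[OF finite_N Suc(3) T(1) meas cov int]) (use that in auto)
  have 2: "(\<integral>x. sector_integrand T \<sigma> \<Phi> H x \<partial>lebesgue_on_coords N)
      = (\<Sum>m\<in>T. \<integral>x. ?g m H x \<partial>lebesgue_on_coords N)" if "1/2 < Re H" for H
    using integral_split_dominant(2)[OF finite_N Suc(3) T(1) meas cov int] that eq
    by (simp cong: sum.cong)
  have "continuable (\<lambda>H. \<integral>x. sector_integrand T \<sigma> \<Phi> H x \<partial>lebesgue_on_coords N)"
    by (rule continuable_cong[OF continuable_sum 2]) (use IH in auto)
  then show ?case using 1 by blast
qed

end

section \<open>The first blow-up, from the simplex of gaps to the cube\<close>

context subset_family
begin

definition simplex_integrand :: "complex \<Rightarrow> (nat \<Rightarrow> real) \<Rightarrow> complex" where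
  "simplex_integrand H x = indicat_real {x. (\<forall>i\<in>N. 0 < x i) \<and> (\<Sum>i\<in>N. x i) < 1} x *\<^sub>R
     (\<Prod>l\<in>L. complex_of_real (\<Sum>i\<in>Q l. x i) powr (-2 + 2 * H))"

text \<open>The first factor comes from rescaling the dominant coordinate \<open>x m\<close> so that \<open>\<Sum>x < 1\<close> turns into
  \<open>x m < 1\<close>.\<close>

definition radial_amplitude :: "nat \<Rightarrow> (nat \<Rightarrow> real) \<Rightarrow> complex \<Rightarrow> complex" where
  "radial_amplitude m x H =
     complex_of_real (1 + (\<Sum>i\<in>N - {m}. x i)) powr
       (of_real (2 * real (card L) - real (card N)) + of_real (- 2 * real (card L)) * H) *
     blown_up N m (\<lambda>_ _. 1) x H"

text \<open>The new dominant coordinate is \<open>r = x m / D\<close> with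
  \<open>D = 1 + (sum of the other x i)\<close>, and the others become \<open>r * x i\<close>; their
  total is then \<open>r * D = x m\<close>. The absolute values in \<open>c\<close> keep the scaling
  factor positive on the whole space and disappear on the cube.\<close>

lemma simplex_integrand_blown_up:
  assumes m: "m \<in> N"
  defines "c \<equiv> \<lambda>x. 1 / (1 + (\<Sum>i\<in>N - {m}. \<bar>x i\<bar>))"
  defines "\<phi> \<equiv> \<lambda>x. x(m := 0 + c x * x m)"
  shows "(c x * (if 0 < \<phi> x m then \<phi> x m else 1) ^ card (N - {m})) *\<^sub>R
      indicat_real (dominant N m) (coord_scale (N - {m}) m (\<phi> x)) *\<^sub>R
      simplex_integrand H (coord_scale (N - {m}) m (\<phi> x))
    = sector_integrand (N - {m}) (\<lambda>_. N) (radial_amplitude m) H x"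
proof -
  let ?A = "N - {m}"
  let ?z = "coord_scale ?A m (\<phi> x)"
  let ?S = "{x. (\<forall>i\<in>N. 0 < x i) \<and> (\<Sum>i\<in>N. x i) < 1}"
  define r where "r = c x * x m"
  define D where "D = 1 + (\<Sum>i\<in>?A. \<bar>x i\<bar>)"
  have D: "0 < D" unfolding D_def by (smt (verit) abs_ge_zero sum_nonneg)
  have cD: "c x = 1 / D" by (simp add: c_def D_def)
  have rD: "x m = r * D" using D by (simp add: r_def cD)
  have zm: "?z m = r" "\<phi> x m = r" by (simp_all add: coord_scale_def \<phi>_def r_def)
  show ?thesis
  proof (cases "0 < r")
    case False
    then have "x m \<le> 0" using D by (simp add: rD mult_nonpos_nonneg)
    then have "?z \<notin> ?S" "x \<notin> open_cube N"
      using m zm False unfolding open_cube_def mem_Collect_eq by (metis, metis not_le)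
    then show ?thesis by (simp add: sector_integrand_def simplex_integrand_def)
  next
    case r: True
    have z: "?z i = r * x i" if "i \<in> ?A" for i
      using that r unfolding coord_scale_def zm(2) by (simp add: \<phi>_def)
    have absx: "\<bar>x i\<bar> = x i" if "\<And>i. i \<in> ?A \<Longrightarrow> 0 < x i" "i \<in> ?A" for i
      using that(1)[OF that(2)] by simp
    have sum_z: "(\<Sum>i\<in>N. ?z i) = x m" if "\<And>i. i \<in> ?A \<Longrightarrow> 0 < x i"
    proof -
      have "(\<Sum>i\<in>N. ?z i) = r + (\<Sum>i\<in>?A. r * x i)"
        unfolding sum.remove[OF finite_N m, of ?z] zm(1) by (intro arg_cong2[where f = "(+)"] sum.cong refl z)
      also have "\<dots> = r * (1 + (\<Sum>i\<in>?A. \<bar>x i\<bar>))"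
        unfolding distrib_left sum_distrib_left
        by (intro arg_cong2[where f = "(+)"] sum.cong) (use absx[OF that] in simp_all)
      finally show ?thesis by (simp add: rD D_def)
    qed
    have dom: "?z \<in> ?S \<and> ?z \<in> dominant N m \<longleftrightarrow> x \<in> open_cube N"
    proof
      assume a: "?z \<in> ?S \<and> ?z \<in> dominant N m"
      have x: "0 < x i \<and> x i < 1" if "i \<in> ?A" for i
      proof -
        have "0 < ?z i" "?z i < ?z m" using a that by (auto simp: dominant_def)
        then have "0 < r * x i" "r * x i < r" unfolding z[OF that] zm .
        then show ?thesis using r by (simp add: zero_less_mult_iff)
      qed
      have "0 < x m" using r D rD by simp
      moreover have "x m < 1" using sum_z x a by auto
      ultimately show "x \<in> open_cube N" using x by (auto simp: open_cube_def)
    next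
      assume x: "x \<in> open_cube N"
      have "0 < r * x i \<and> r * x i < r" if "i \<in> ?A" for i
        using x that r by (auto simp: open_cube_def)
      then have zi: "0 < ?z i \<and> ?z i < r" if "i \<in> ?A" for i using z that by simp
      have "0 < ?z i" if "i \<in> N" for i using zi[of i] that r zm by (cases "i = m") auto
      moreover have "(\<Sum>i\<in>N. ?z i) < 1" using sum_z x m by (auto simp: open_cube_def)
      moreover have "?z \<in> dominant N m" using zi by (simp add: dominant_def zm)
      ultimately show "?z \<in> ?S \<and> ?z \<in> dominant N m" by simp
    qed
    show ?thesis
    proof (cases "x \<in> open_cube N")
      case False
      then have "indicat_real (dominant N m) ?z * indicat_real ?S ?z = 0"
        using dom by (auto simp: indicator_def)
      then show ?thesis using False by (auto simp: sector_integrand_def simplex_integrand_def)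
    next
      case x: True
      have xpos: "0 < x i" if "i \<in> ?A" for i using x that by (simp add: open_cube_def)
      have insideN: "inside N = L" using Q_subset by (auto simp: inside_def)
      have DS: "D = 1 + (\<Sum>i\<in>?A. x i)" unfolding D_def
        by (intro arg_cong2[where f = "(+)"] sum.cong refl absx xpos)
      have P1: "(\<Prod>j\<in>N - ?A. complex_of_real (x j) powr exponent N H) = complex_of_real (x m) powr exponent N H"
      proof -
        have "N - ?A = {m}" using m by auto
        then show ?thesis by simp
      qed
      have P3: "(\<Prod>l\<in>L. complex_of_real (\<Sum>i\<in>Q l. ?z i) powr (-2 + 2 * H)) =
        complex_of_real r powr (of_nat (card L) * (-2 + 2 * H)) *
        (\<Prod>l\<in>inside ?A. complex_of_real (\<Sum>i\<in>Q l. x i) powr (-2 + 2 * H)) *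
        (\<Prod>l\<in>{l\<in>L. m \<in> Q l}. complex_of_real (1 + (\<Sum>i\<in>Q l - {m}. x i)) powr (-2 + 2 * H))"
        using pair_product_scaled[where T = N and m = m and r = r and x = x and z = ?z and w = "-2 + 2 * H"]
          m r xpos zm(1) z unfolding insideN by blast
      have ex: "exponent N H = (of_real (real (card N) - 2 * real (card L)) + of_real (2 * real (card L)) * H) - 1"
        by (simp add: exponent_def insideN)
      \<comment> \<open>The power of \<open>D\<close> in \<open>radial_amplitude\<close> is chosen
        so that the two exponents add up to -1: what survives is \<open>1 / D = c x\<close>, the
        Jacobian of the rescaling.\<close>
      have "complex_of_real D powr exponent N H *
          complex_of_real D powr (of_real (2 * real (card L) - real (card N)) + of_real (- 2 * real (card L)) * H)
        = complex_of_real D powr (- 1)"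
        unfolding powr_add[symmetric] ex by (simp add: algebra_simps)
      also have "\<dots> = of_real (c x)" using D by (simp add: powr_minus cD inverse_eq_divide)
      finally have P5: "complex_of_real D powr exponent N H *
          complex_of_real D powr (of_real (2 * real (card L) - real (card N)) + of_real (- 2 * real (card L)) * H)
        = of_real (c x)" .
      have P6: "complex_of_real (x m) powr exponent N H
          = complex_of_real r powr exponent N H * complex_of_real D powr exponent N H"
        unfolding rD of_real_mult using r D by (intro powr_times_real) auto
      have P4: "complex_of_real r powr exponent N H = complex_of_real r ^ card ?A *
          complex_of_real r powr (of_nat (card L) * (-2 + 2 * H))"
        using powr_exponent[OF _ subset_refl r, of H] m finite_N by (auto simp: insideN)
      have "sector_integrand ?A (\<lambda>_. N) (radial_amplitude m) H x
          = complex_of_real r powr exponent N H *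
            (complex_of_real D powr exponent N H *
            complex_of_real D powr (of_real (2 * real (card L) - real (card N)) + of_real (- 2 * real (card L)) * H)) *
            (\<Prod>l\<in>inside ?A. complex_of_real (\<Sum>i\<in>Q l. x i) powr (-2 + 2 * H)) *
            (\<Prod>l\<in>{l\<in>L. m \<in> Q l}. complex_of_real (1 + (\<Sum>i\<in>Q l - {m}. x i)) powr (-2 + 2 * H))"
        unfolding sector_integrand_def P1 P6 radial_amplitude_def blown_up_def insideN DS[symmetric]
        using x by simp
      also have "\<dots> = complex_of_real r ^ card ?A * of_real (c x) *
          (\<Prod>l\<in>L. complex_of_real (\<Sum>i\<in>Q l. ?z i) powr (-2 + 2 * H))"
        unfolding P5 P4 P3 by (simp only: mult_ac)
      finally show ?thesis
        unfolding simplex_integrand_def zm using dom x r by (simp add: scaleR_conv_of_real)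
    qed
  qed
qed

lemma amplitude_radial:
  assumes "m \<in> N"
  shows "amplitude N (radial_amplitude m)"
proof -
  have "amplitude N (\<lambda>_ _. 1)" by (rule amplitude_entire) simp
  then show ?thesis unfolding radial_amplitude_def[abs_def]
    by (intro amplitude_mult amplitude_coord_sum_powr amplitude_blown_up assms) auto
qed

lemma simplex_integrand_measurable:
  "simplex_integrand H \<in> borel_measurable (lebesgue_on_coords N)"
proof -
  let ?M = "lebesgue_on_coords N"
  have x: "(\<lambda>x. x i) \<in> borel_measurable ?M" if "i \<in> N" for i using that by (rule measurable_coord)
  then have s: "(\<lambda>x. \<Sum>i\<in>A. x i) \<in> borel_measurable ?M" if "A \<subseteq> N" for A
    using that by (intro borel_measurable_sum) auto
  have "{x \<in> space ?M. (\<forall>i\<in>N. 0 < x i) \<and> (\<Sum>i\<in>N. x i) < 1} \<in> sets ?M"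
    using finite_N x s[of N]
    by (intro sets.sets_Collect_conj sets.sets_Collect_finite_All borel_measurable_less) auto
  moreover have "indicat_real {x. (\<forall>i\<in>N. 0 < x i) \<and> (\<Sum>i\<in>N. x i) < 1} x
      = indicat_real {x \<in> space ?M. (\<forall>i\<in>N. 0 < x i) \<and> (\<Sum>i\<in>N. x i) < 1} x" if "x \<in> space ?M" for x
    using that by (auto simp: indicator_def)
  ultimately have 1: "indicat_real {x. (\<forall>i\<in>N. 0 < x i) \<and> (\<Sum>i\<in>N. x i) < 1} \<in> borel_measurable ?M"
    by (subst measurable_cong) auto
  have 2: "(\<lambda>x. complex_of_real (\<Sum>i\<in>Q l. x i) powr (-2 + 2 * H)) \<in> borel_measurable ?M" if "l \<in> L" for l
  proof -
    note [measurable] = s[OF Q_subset[OF that]]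
    show ?thesis unfolding powr_def by measurable
  qed
  show ?thesis unfolding simplex_integrand_def[abs_def]
    by (intro borel_measurable_scaleR borel_measurable_prod 1 2)
qed

lemma simplex_integral_continuable:
  assumes "N \<noteq> {}"
  shows "\<forall>H. 1/2 < Re H \<longrightarrow> integrable (lebesgue_on_coords N) (simplex_integrand H)"
    and "continuable (\<lambda>H. \<integral>x. simplex_integrand H x \<partial>lebesgue_on_coords N)"
proof -
  let ?M = "lebesgue_on_coords N"
  define c where "c m x = 1 / (1 + (\<Sum>i\<in>N - {m}. \<bar>x i\<bar>))" for m :: nat and x :: "nat \<Rightarrow> real"
  define \<phi> where "\<phi> m x = x(m := 0 + c m x * x m)" for m x
  define \<psi> where "\<psi> m x = coord_scale (N - {m}) m (\<phi> m x)" for m x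
  define J where "J m x = c m x * (if 0 < \<phi> m x m then \<phi> m x m else 1) ^ card (N - {m})" for m x
  \<comment> \<open>After this first step only \<open>m\<close> is resolved, and all of
    \<open>N\<close> was in play when it was chosen, hence the constant choice for
    \<open>\<sigma>\<close>.\<close>
  let ?g = "\<lambda>m. sector_integrand (N - {m}) (\<lambda>_. N) (radial_amplitude m)"
  have g: "(\<forall>H. 1/2 < Re H \<longrightarrow> integrable ?M (?g m H)) \<and> continuable (\<lambda>H. \<integral>x. ?g m H x \<partial>?M)"
    if "m \<in> N" for m
    using that assms by (intro sector_integral_continuable amplitude_radial) auto
  have cov: "change_of_variables ?M (\<psi> m) (J m)" if m: "m \<in> N" for m
  proof -
    have c[measurable]: "c m \<in> borel_measurable ?M"
      unfolding c_def[abs_def]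
      by (intro borel_measurable_divide borel_measurable_add borel_measurable_sum borel_measurable_abs
          measurable_coord borel_measurable_const) auto
    have "0 < 1 + (\<Sum>i\<in>N - {m}. \<bar>x i\<bar>)" for x :: "nat \<Rightarrow> real"
      by (smt (verit) abs_ge_zero sum_nonneg)
    then have "change_of_variables ?M (\<phi> m) (c m)"
      unfolding \<phi>_def
      by (intro change_of_variables_affine[OF finite_N m]) (auto simp: c_def c[unfolded c_def[abs_def]] intro!: sum.cong)
    moreover have "change_of_variables ?M (coord_scale (N - {m}) m) (\<lambda>x. (if 0 < x m then x m else 1) ^ card (N - {m}))"
      using m by (intro change_of_variables_coord_scale finite_N) auto
    ultimately show ?thesis
      unfolding \<psi>_def J_def by (intro change_of_variables_compose)
  qed
  have eq: "J m x *\<^sub>R indicat_real (dominant N m) (\<psi> m x) *\<^sub>R simplex_integrand H (\<psi> m x) = ?g m H x"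
    if "m \<in> N" for m H x
    unfolding J_def \<psi>_def \<phi>_def c_def by (rule simplex_integrand_blown_up[OF that])
  have int: "integrable ?M (\<lambda>x. J m x *\<^sub>R indicat_real (dominant N m) (\<psi> m x) *\<^sub>R simplex_integrand H (\<psi> m x))"
    if "m \<in> N" "1/2 < Re H" for m H
    unfolding eq[OF that(1)] using g that by blast
  show "\<forall>H. 1/2 < Re H \<longrightarrow> integrable ?M (simplex_integrand H)"
    using integral_split_dominant(1)[OF finite_N subset_refl assms simplex_integrand_measurable cov int] by blast
  have 2: "(\<integral>x. simplex_integrand H x \<partial>?M) = (\<Sum>m\<in>N. \<integral>x. ?g m H x \<partial>?M)" if "1/2 < Re H" for H
    using integral_split_dominant(2)[OF finite_N subset_refl assms simplex_integrand_measurable cov int] that eq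
    by (simp cong: sum.cong)
  show "continuable (\<lambda>H. \<integral>x. simplex_integrand H x \<partial>?M)"
    by (rule continuable_cong[OF continuable_sum 2]) (use g in auto)
qed

end

section \<open>Blocks and nonadjacent intervals\<close>

text \<open>Peel off the rightmost maximal run \<open>{a..b}\<close> of \<open>S\<close>. By
  minimality of \<open>a\<close>, the point \<open>a - 1\<close> is missing from \<open>S\<close>,
  so everything left over ends at least two before \<open>a\<close>.\<close>

lemma nonadjacent_collection_exists:
  assumes "S \<subseteq> {1..2*k}"
  shows "\<exists>C. nonadjacent_collection k C \<and> \<Union>C = S"
  using assms
proof (induction "card S" arbitrary: S rule: less_induct)
  case less
  show ?case
  proof (cases "S = {}")
    case True
    then show ?thesis by (intro exI[of _ "{}"]) (auto simp: nonadjacent_collection_def)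
  next
    case False
    have fin: "finite S" using less.prems finite_subset by blast
    define b where "b = Max S"
    have b: "b \<in> S" "\<And>x. x \<in> S \<Longrightarrow> x \<le> b" using fin False by (auto simp: b_def)
    define a where "a = (LEAST a. {a..b} \<subseteq> S)"
    have ab: "{a..b} \<subseteq> S" unfolding a_def by (rule LeastI[of _ b]) (use b in auto)
    have "a \<le> b" unfolding a_def by (rule Least_le) (use b in auto)
    then have aS: "a \<in> S" using ab by auto
    then have a1: "1 \<le> a" "b \<le> 2*k" using b(1) less.prems by auto
    have gap: "a - 1 \<notin> S"
    proof
      assume "a - 1 \<in> S"
      moreover have "{a - 1..b} \<subseteq> insert (a - 1) {a..b}" by auto
      ultimately have "{a - 1..b} \<subseteq> S" using ab by (meson insert_subset order_trans)
      then have "a \<le> a - 1" unfolding a_def by (rule Least_le)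
      then show False using a1 by linarith
    qed
    have "card (S - {a..b}) < card S"
      using aS \<open>a \<le> b\<close> fin by (intro psubset_card_mono) auto
    then obtain C where C: "nonadjacent_collection k C" "\<Union>C = S - {a..b}"
      using less.hyps[of "S - {a..b}"] less.prems by (meson Diff_subset order_trans)
    have left: "Max J + 2 \<le> Min {a..b}" if "J \<in> C" for J
    proof -
      obtain c d where J: "c \<le> d" "J = {c..d}"
        using C(1) \<open>J \<in> C\<close> unfolding nonadjacent_collection_def subinterval_def by meson
      then have "d \<in> \<Union>C" using that by auto
      then have "d \<in> S" "d \<notin> {a..b}" unfolding C(2) by auto
      then have "d < a" "d \<noteq> a - 1" using b(2) gap by auto
      moreover have "Max J = d" "Min {a..b} = a"
        using J \<open>a \<le> b\<close> by (auto intro: Max_eqI Min_eqI)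
      ultimately show ?thesis by linarith
    qed
    have "nonadjacent_collection k (insert {a..b} C)"
      using C(1) left a1 \<open>a \<le> b\<close>
      by (auto simp: nonadjacent_collection_def pairwise_insert subinterval_def)
    moreover have "\<Union>(insert {a..b} C) = S" using C(2) ab by auto
    ultimately show ?thesis by blast
  qed
qed

text \<open>Allowing \<open>s\<close> and \<open>t\<close> to differ by one covers two uses:
  disjointness, with \<open>s = t\<close>, and the impossibility of passing from one member to
  another between neighbouring points.\<close>

lemma nonadjacent_collection_disjoint:
  assumes C: "nonadjacent_collection k C" and "I \<in> C" "J \<in> C" "I \<noteq> J"
  shows "\<not> (s \<in> I \<and> t \<in> J \<and> s \<le> t + 1 \<and> t \<le> s + 1)"
proof
  assume st: "s \<in> I \<and> t \<in> J \<and> s \<le> t + 1 \<and> t \<le> s + 1"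
  have "finite I" "finite J"
    using assms by (auto simp: nonadjacent_collection_def subinterval_def)
  then have "s \<le> Max I" "Min I \<le> s" "t \<le> Max J" "Min J \<le> t" using st by auto
  moreover have "Max I + 2 \<le> Min J \<or> Max J + 2 \<le> Min I"
    using assms by (auto simp: nonadjacent_collection_def pairwise_def)
  ultimately show False using st by linarith
qed

text \<open>Walking down from \<open>hi\<close>, a change of member would put neighbouring points
  into two different members. Hence counting blocks inside the union reduces to counting them inside
  the members.\<close>

lemma interval_within_nonadjacent_collection:
  assumes C: "nonadjacent_collection k C" and "lo < hi" "{lo+1..hi} \<subseteq> \<Union>C"
  shows "\<exists>I\<in>C. {lo+1..hi} \<subseteq> I"
proof -
  have "hi \<in> {lo+1..hi}" using assms(2) by simp
  then have "hi \<in> \<Union>C" using assms(3) by (rule rev_subsetD)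
  then obtain I where I: "I \<in> C" "hi \<in> I" by blast
  have "t \<in> I" if "t \<le> hi" "lo + 1 \<le> t" for t
    using that
  proof (induction t rule: inc_induct)
    case base
    then show ?case using I by simp
  next
    case (step t)
    then have "Suc t \<in> I" "t \<in> {lo+1..hi}" by auto
    then have "Suc t \<in> I" "t \<in> \<Union>C" using assms(3) by blast+
    then obtain J where J: "J \<in> C" "t \<in> J" by blast
    then have "J = I"
      using nonadjacent_collection_disjoint[OF C I(1) J(1), of "Suc t" t] \<open>Suc t \<in> I\<close> by auto
    then show ?case using J by simp
  qed
  then have "{lo+1..hi} \<subseteq> I" by auto
  then show ?thesis using I(1) by blast
qed

section \<open>Blocks as sets of gaps and the meaning of the denominator\<close>

locale pair_blocks =
  fixes k :: nat and P :: "nat set set" and j1 j2 :: "nat \<Rightarrow> nat"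
  assumes partition: "pair_partition k P" and blocks: "P = (\<lambda>l. {j1 l, j2 l}) ` {1..k}"
begin

definition lower :: "nat \<Rightarrow> nat" where "lower l = min (j1 l) (j2 l)"
definition upper :: "nat \<Rightarrow> nat" where "upper l = max (j1 l) (j2 l)"
text \<open>Gap \<open>i\<close> lies between the points \<open>i - 1\<close> and \<open>i\<close>.\<close>

definition gaps :: "nat \<Rightarrow> nat set" where "gaps l = {lower l + 1..upper l}"

lemma block_eq: "{j1 l, j2 l} = {lower l, upper l}"
  by (auto simp: lower_def upper_def min_def max_def)

lemma block:
  assumes "l \<in> {1..k}"
  shows "1 \<le> lower l" "lower l < upper l" "upper l \<le> 2*k" "{lower l, upper l} \<in> P"
proof -
  show P: "{lower l, upper l} \<in> P" using assms blocks block_eq by auto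
  have "card {lower l, upper l} = 2" "{lower l, upper l} \<subseteq> {1..2*k}"
    using partition P by (auto simp: pair_partition_def partition_on_def)
  moreover have "lower l \<le> upper l" by (simp add: lower_def upper_def)
  moreover have "lower l \<noteq> upper l" using calculation(1) by auto
  ultimately show "1 \<le> lower l" "lower l < upper l" "upper l \<le> 2*k" by auto
qed

text \<open>Since \<open>P\<close> has exactly \<open>k\<close> members, its enumeration over
  \<open>{1..k}\<close> has no repetitions, so different indices give different, hence disjoint,
  blocks.\<close>

lemma blocks_disjoint:
  assumes "l \<in> {1..k}" "l' \<in> {1..k}" "l \<noteq> l'"
  shows "{lower l, upper l} \<inter> {lower l', upper l'} = {}"
proof -
  have "card ((\<lambda>l. {j1 l, j2 l}) ` {1..k}) = card {1..k}"
    using partition blocks by (auto simp: pair_partition_def)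
  then have "inj_on (\<lambda>l. {j1 l, j2 l}) {1..k}" by (intro eq_card_imp_inj_on) auto
  from inj_onD[OF this _ assms(1,2)] have "{j1 l, j2 l} \<noteq> {j1 l', j2 l'}" using assms(3) by blast
  then have "{lower l, upper l} \<noteq> {lower l', upper l'}" by (simp only: block_eq simp_thms)
  moreover have "disjoint P" using partition by (simp add: pair_partition_def partition_on_def)
  ultimately show ?thesis by (intro disjointD[of P] block(4) assms)
qed

lemma paired_iff: "paired P x y \<longleftrightarrow>
    (\<exists>l\<in>{1..k}. x = lower l \<and> y = upper l \<or> x = upper l \<and> y = lower l)"
proof
  assume "paired P x y"
  then have xy: "x \<noteq> y" "{x, y} \<in> P" by (auto simp: paired_def)
  then obtain l where l: "l \<in> {1..k}" "{x, y} = {lower l, upper l}" using blocks block_eq by auto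
  then show "\<exists>l\<in>{1..k}. x = lower l \<and> y = upper l \<or> x = upper l \<and> y = lower l"
    by (intro bexI[of _ l]) (auto simp: doubleton_eq_iff)
next
  assume "\<exists>l\<in>{1..k}. x = lower l \<and> y = upper l \<or> x = upper l \<and> y = lower l"
  then obtain l where l: "l \<in> {1..k}" "x = lower l \<and> y = upper l \<or> x = upper l \<and> y = lower l" by blast
  then show "paired P x y"
    using block(2,4)[OF l(1)] by (auto simp: paired_def insert_commute)
qed

text \<open>\<open>Def\<close> is contained in \<open>Aug\<close>, and the difference is the
  disjoint union of the blocks with both elements in \<open>{a - 1..b}\<close>. These are exactly
  the blocks whose gaps lie in \<open>I\<close>, and each has two elements.\<close>

lemma card_Aug_minus_card_Def:
  assumes "subinterval k I"
  shows "int (card (Aug k P I)) - int (card (Def k P I)) = 2 * int (card {l \<in> {1..k}. gaps l \<subseteq> I})"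
proof -
  obtain a b where ab: "1 \<le> a" "a \<le> b" "b \<le> 2*k" "I = {a..b}"
    using assms by (auto simp: subinterval_def)
  let ?A = "Aug k P I" and ?D = "Def k P I" and ?X = "{l \<in> {1..k}. gaps l \<subseteq> I}"
  have A: "?A = (if a - 1 \<in> {1..2*k} \<and> (\<exists>q\<in>I. paired P (a - 1) q) then I \<union> {a - 1} else I)"
  proof -
    have "Min I = a" using ab by (auto intro: Min_eqI)
    then show ?thesis unfolding Aug_def Let_def by (simp only:)
  qed
  have IA: "I \<subseteq> ?A" and finA: "finite ?A" and A_sub: "?A \<subseteq> {a - 1..b}"
    unfolding A using ab by auto
  have DA: "?D \<subseteq> ?A" using IA by (auto simp: Def_def)
  have X: "l \<in> ?X \<longleftrightarrow> l \<in> {1..k} \<and> a - 1 \<le> lower l \<and> upper l \<le> b" for l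
    using block[of l] ab by (auto simp: gaps_def)
  have 1: "{lower l, upper l} \<subseteq> ?A - ?D" if "l \<in> ?X" for l
  proof -
    have l: "l \<in> {1..k}" "a - 1 \<le> lower l" "upper l \<le> b" using that X by auto
    note lb = block[OF l(1)]
    have p: "paired P (lower l) (upper l)" "paired P (upper l) (lower l)" using l(1) paired_iff by blast+
    have u: "upper l \<in> I" using l lb ab by auto
    have lA: "lower l \<in> ?A"
    proof (cases "lower l \<in> I")
      case False
      then have "lower l = a - 1" using l lb ab by auto
      then show ?thesis using p(1) u lb ab unfolding A by auto
    qed (use IA in auto)
    have "lower l \<notin> ?D" "upper l \<notin> ?D" using p lA u IA by (auto simp: Def_def)
    then show ?thesis using lA u IA by auto
  qed
  have 2: "\<exists>l\<in>?X. x \<in> {lower l, upper l}" if x: "x \<in> ?A - ?D" for x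
  proof -
    \<comment> \<open>A point of \<open>Aug\<close> outside \<open>I\<close> was added because it is
      paired with an element of \<open>I\<close>; a point of \<open>I\<close> outside
      \<open>Def\<close> has its partner in \<open>Aug\<close> by definition.\<close>
    have "\<exists>y\<in>?A. paired P x y"
      using x IA unfolding A Def_def by (auto split: if_splits)
    then obtain y where y: "y \<in> ?A" "paired P x y" by blast
    then obtain l where l: "l \<in> {1..k}" "x = lower l \<and> y = upper l \<or> x = upper l \<and> y = lower l"
      using paired_iff by blast
    have "{lower l, upper l} \<subseteq> {a - 1..b}" using l(2) x y(1) A_sub by blast
    then have "l \<in> ?X" using l(1) X by auto
    then show ?thesis using l(2) by blast
  qed
  have "?A - ?D = (\<Union>l\<in>?X. {lower l, upper l})" using 1 2 by blast
  then have "card (?A - ?D) = (\<Sum>l\<in>?X. card {lower l, upper l})"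
    using blocks_disjoint by (simp only:) (rule card_UN_disjoint, auto)
  also have "\<dots> = (\<Sum>l\<in>?X. 2)"
  proof (rule sum.cong[OF refl])
    fix l assume "l \<in> ?X"
    then have "lower l < upper l" using block(2) by blast
    then show "card {lower l, upper l} = 2" by simp
  qed
  finally have "card (?A - ?D) = 2 * card ?X" by simp
  moreover have "card (?A - ?D) = card ?A - card ?D" "card ?D \<le> card ?A"
    using DA finA by (auto intro: card_Diff_subset card_mono finite_subset)
  ultimately show ?thesis by linarith
qed

lemma denom_nonadjacent_collection:
  assumes C: "nonadjacent_collection k C"
  shows "denom k P C = 2 * int (card {l \<in> {1..k}. gaps l \<subseteq> \<Union>C})"
    and "(\<Sum>I\<in>C. card I) = card (\<Union>C)"
proof -
  have sub: "subinterval k I" if "I \<in> C" for I using C that by (auto simp: nonadjacent_collection_def)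
  have finI: "finite I" "I \<subseteq> {1..2*k}" if "I \<in> C" for I
    using sub[OF that] by (auto simp: subinterval_def)
  then have "C \<subseteq> Pow {1..2*k}" by blast
  then have finC: "finite C" by (rule finite_subset) simp
  have disj: "I \<inter> J = {}" if "I \<in> C" "J \<in> C" "I \<noteq> J" for I J
  proof (rule ccontr)
    assume "I \<inter> J \<noteq> {}"
    then obtain s where "s \<in> I" "s \<in> J" by blast
    then show False using nonadjacent_collection_disjoint[OF C that, of s s] by simp
  qed
  then show "(\<Sum>I\<in>C. card I) = card (\<Union>C)"
    using finI by (intro card_Union_disjoint[symmetric]) (auto simp: disjoint_def pairwise_def disjnt_def)
  let ?X = "\<lambda>S. {l \<in> {1..k}. gaps l \<subseteq> S}"
  have gl: "upper l \<in> gaps l" if "l \<in> {1..k}" for l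
    using block(2)[OF that] by (simp add: gaps_def)
  have "\<exists>I\<in>C. gaps l \<subseteq> I" if "l \<in> {1..k}" "gaps l \<subseteq> \<Union>C" for l
    using interval_within_nonadjacent_collection[OF C block(2)[OF that(1)]] that(2)
    unfolding gaps_def .
  then have "?X (\<Union>C) = (\<Union>I\<in>C. ?X I)" by (intro equalityI subsetI) auto
  moreover have "card (\<Union>I\<in>C. ?X I) = (\<Sum>I\<in>C. card (?X I))"
  proof (rule card_UN_disjoint[OF finC])
    show "\<forall>I\<in>C. \<forall>J\<in>C. I \<noteq> J \<longrightarrow> ?X I \<inter> ?X J = {}"
    proof (intro ballI impI)
      fix I J assume "I \<in> C" "J \<in> C" "I \<noteq> J"
      from disj[OF this] show "?X I \<inter> ?X J = {}" using gl by blast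
    qed
  qed simp
  ultimately show "denom k P C = 2 * int (card (?X (\<Union>C)))"
    unfolding denom_def using card_Aug_minus_card_Def sub by (simp add: sum_distrib_left)
qed

text \<open>The right end of a block is the number of its last gap, and disjoint blocks have
  different right ends.\<close>

lemma card_gaps_inside_le:
  assumes "finite S"
  shows "card {l \<in> {1..k}. gaps l \<subseteq> S} \<le> card S"
proof (rule card_inj_on_le[of upper])
  show "inj_on upper {l \<in> {1..k}. gaps l \<subseteq> S}"
    using blocks_disjoint by (intro inj_onI) blast
  show "upper ` {l \<in> {1..k}. gaps l \<subseteq> S} \<subseteq> S"
    using block(2) by (fastforce simp: gaps_def)
qed fact

end

section \<open>The integral over the simplex in gap coordinates\<close>

text \<open>Stopping at coordinate \<open>k\<close> makes consecutive maps differ by a single shear,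
  which adds the partial sum already stored in coordinate \<open>k\<close> to coordinate
  \<open>Suc k\<close>.\<close>

definition cumulative :: "nat \<Rightarrow> (nat \<Rightarrow> real) \<Rightarrow> nat \<Rightarrow> real" where
  "cumulative k x = (\<lambda>i. if i \<in> {1..k} then \<Sum>i'=1..i. x i' else x i)"

lemma change_of_variables_cumulative:
  "k \<le> n \<Longrightarrow> change_of_variables (lebesgue_on_coords {1..n}) (cumulative k) (\<lambda>_. 1)"
proof (induction k)
  case 0
  have "cumulative 0 = (\<lambda>x. x)" by (simp add: cumulative_def fun_eq_iff)
  then show ?case using change_of_variables_id by simp
next
  case (Suc k)
  let ?M = "lebesgue_on_coords {1..n}"
  \<comment> \<open>The first partial sum is \<open>x 1\<close> itself, and 0 is not among the
    coordinates \<open>{1..n}\<close>.\<close>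
  let ?a = "\<lambda>x::nat \<Rightarrow> real. if k = 0 then 0 else x k"
  have "?a \<in> borel_measurable ?M"
    using Suc.prems measurable_coord[of k "{1..n}"] by (cases "k = 0") auto
  then have 1: "change_of_variables ?M (\<lambda>x. x(Suc k := ?a x + 1 * x (Suc k))) (\<lambda>_. 1)"
    by (rule change_of_variables_affine[rotated 2]) (use Suc.prems in auto)
  have e: "(cumulative k x)(Suc k := ?a (cumulative k x) + 1 * cumulative k x (Suc k)) = cumulative (Suc k) x" for x
    by (auto simp: cumulative_def fun_eq_iff le_Suc_eq)
  show ?case
    using change_of_variables_compose[OF 1 Suc.IH] Suc.prems unfolding e by simp
qed

context pair_blocks
begin

sublocale subset_family "{1..2*k}" "{1..k}" gaps
proof
  show "gaps l \<subseteq> {1..2*k}" if "l \<in> {1..k}" for l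
    using block[OF that] by (auto simp: gaps_def)
  show "gaps l \<noteq> {}" if "l \<in> {1..k}" for l
    using block[OF that] by (auto simp: gaps_def)
  show "card {l \<in> {1..k}. gaps l \<subseteq> S} \<le> card S" if "S \<subseteq> {1..2*k}" for S
    using that by (intro card_gaps_inside_le finite_subset[OF that]) auto
qed auto

lemma cumulative_open_simplex:
  assumes x: "x \<in> space (lebesgue_on_coords {1..2*k})" and k: "1 \<le> k"
  shows "cumulative (2*k) x \<in> open_simplex (2*k) \<longleftrightarrow>
    (\<forall>i\<in>{1..2*k}. 0 < x i) \<and> (\<Sum>i\<in>{1..2*k}. x i) < 1"
proof -
  let ?s = "cumulative (2*k) x"
  have s: "?s i = (\<Sum>i'=1..i. x i')" if "i \<in> {1..2*k}" for i using that by (simp add: cumulative_def)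
  \<comment> \<open>Members of \<open>open_simplex\<close> are extensional, and
    \<open>cumulative\<close> leaves the values outside \<open>{1..2*k}\<close> untouched.\<close>
  have ext: "?s \<in> {1..2*k} \<rightarrow>\<^sub>E UNIV"
    using x by (auto simp: cumulative_def space_PiM PiE_def extensional_def)
  have s1: "?s 1 = x 1" using s[of 1] k by simp
  have step: "?s i < ?s (Suc i) \<longleftrightarrow> 0 < x (Suc i)" if "i \<in> {1..<2*k}" for i
    using s[of i] s[of "Suc i"] that by simp
  have "?s \<in> open_simplex (2*k) \<longleftrightarrow>
      0 < ?s 1 \<and> (\<forall>i\<in>{1..<2*k}. ?s i < ?s (Suc i)) \<and> ?s (2*k) < 1"
    unfolding open_simplex_def using ext by blast
  also have "\<dots> \<longleftrightarrow> (0 < x 1 \<and> (\<forall>i\<in>{1..<2*k}. 0 < x (Suc i))) \<and> (\<Sum>i\<in>{1..2*k}. x i) < 1"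
    using s1 step s[of "2*k"] k by auto
  also have "0 < x 1 \<and> (\<forall>i\<in>{1..<2*k}. 0 < x (Suc i)) \<longleftrightarrow> (\<forall>i\<in>{1..2*k}. 0 < x i)" (is "?L \<longleftrightarrow> ?R")
  proof
    assume L: ?L
    show ?R
    proof
      fix i assume i: "i \<in> {1..2*k}"
      show "0 < x i"
      proof (cases "i = 1")
        case False
        then have "i - 1 \<in> {1..<2*k}" "Suc (i - 1) = i" using i by auto
        then show ?thesis using L by metis
      qed (use L in simp)
    qed
  next
    assume ?R
    then show ?L using k by auto
  qed
  finally show ?thesis by blast
qed

lemma L_integrand_cumulative:
  assumes "\<forall>i\<in>{1..2*k}. 0 < x i"
  shows "L_integrand k j1 j2 H (cumulative (2*k) x)
    = (\<Prod>l=1..k. complex_of_real (\<Sum>i\<in>gaps l. x i) powr (-2 + 2 * H))"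
  unfolding L_integrand_def
proof (rule prod.cong[OF refl])
  fix l assume l: "l \<in> {1..k}"
  let ?s = "cumulative (2*k) x"
  note b = block[OF l]
  have "{1..upper l} = {1..lower l} \<union> gaps l" "{1..lower l} \<inter> gaps l = {}"
    using b by (auto simp: gaps_def)
  then have "?s (upper l) = ?s (lower l) + (\<Sum>i\<in>gaps l. x i)"
    using b by (simp add: cumulative_def sum.union_disjoint gaps_def)
  moreover have "0 \<le> (\<Sum>i\<in>gaps l. x i)"
    using assms b by (intro sum_nonneg) (auto simp: gaps_def intro: less_imp_le)
  moreover have "\<bar>?s (j1 l) - ?s (j2 l)\<bar> = \<bar>?s (upper l) - ?s (lower l)\<bar>"
    by (auto simp: upper_def lower_def max_def min_def)
  ultimately have "\<bar>?s (j1 l) - ?s (j2 l)\<bar> = (\<Sum>i\<in>gaps l. x i)" by simp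
  then show "complex_of_real \<bar>?s (j1 l) - ?s (j2 l)\<bar> powr (2 * H - 2)
      = complex_of_real (\<Sum>i\<in>gaps l. x i) powr (-2 + 2 * H)" by (simp add: algebra_simps)
qed

lemma L_integrand_measurable:
  assumes "1 \<le> k"
  shows "(\<lambda>s. indicat_real (open_simplex (2*k)) s *\<^sub>R L_integrand k j1 j2 H s)
    \<in> borel_measurable (lebesgue_power (2*k))"
proof -
  let ?M = "lebesgue_power (2*k)"
  have s: "(\<lambda>s. s i) \<in> borel_measurable ?M" if "i \<in> {1..2*k}" for i using that by (rule measurable_coord)
  have "{s \<in> space ?M. 0 < s 1 \<and> (\<forall>i\<in>{1..<2*k}. s i < s (Suc i)) \<and> s (2*k) < 1} \<in> sets ?M"
    using assms
    by (intro sets.sets_Collect_conj sets.sets_Collect_finite_All borel_measurable_less s) auto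
  also have "{s \<in> space ?M. 0 < s 1 \<and> (\<forall>i\<in>{1..<2*k}. s i < s (Suc i)) \<and> s (2*k) < 1} = open_simplex (2*k)"
    by (auto simp: open_simplex_def space_PiM)
  finally have 1: "indicat_real (open_simplex (2*k)) \<in> borel_measurable ?M" by simp
  have 2: "(\<lambda>s. complex_of_real \<bar>s (j1 l) - s (j2 l)\<bar> powr (2 * H - 2)) \<in> borel_measurable ?M"
    if "l \<in> {1..k}" for l
  proof -
    have "{j1 l, j2 l} \<subseteq> {1..2*k}" unfolding block_eq using block[OF that] by auto
    then have [measurable]: "(\<lambda>s. s (j1 l)) \<in> borel_measurable ?M" "(\<lambda>s. s (j2 l)) \<in> borel_measurable ?M"
      by (auto intro: s)
    show ?thesis unfolding powr_def by measurable
  qed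
  show ?thesis unfolding L_integrand_def
    by (intro borel_measurable_scaleR borel_measurable_prod 1 2)
qed

lemma L_integral_eq_simplex_integral:
  assumes k: "1 \<le> k"
  shows "set_integrable (lebesgue_power (2*k)) (open_simplex (2*k)) (L_integrand k j1 j2 H) \<longleftrightarrow>
      integrable (lebesgue_power (2*k)) (simplex_integrand H)"
    and "L_integral k j1 j2 H = (\<integral>x. simplex_integrand H x \<partial>lebesgue_power (2*k))"
proof -
  let ?M = "lebesgue_power (2*k)"
  let ?f = "\<lambda>s. indicat_real (open_simplex (2*k)) s *\<^sub>R L_integrand k j1 j2 H s"
  have eq: "1 *\<^sub>R ?f (cumulative (2*k) x) = simplex_integrand H x" if "x \<in> space ?M" for x
  proof (cases "(\<forall>i\<in>{1..2*k}. 0 < x i) \<and> (\<Sum>i\<in>{1..2*k}. x i) < 1")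
    case True
    then have "cumulative (2*k) x \<in> open_simplex (2*k)" using cumulative_open_simplex[OF that k] by blast
    moreover have "x \<in> {x. (\<forall>i\<in>{1..2*k}. 0 < x i) \<and> (\<Sum>i\<in>{1..2*k}. x i) < 1}" using True by simp
    ultimately show ?thesis
      unfolding simplex_integrand_def L_integrand_cumulative[OF conjunct1[OF True]]
      by (simp only: indicator_simps scaleR_one)
  next
    case False
    then have "cumulative (2*k) x \<notin> open_simplex (2*k)" using cumulative_open_simplex[OF that k] by blast
    moreover have "x \<notin> {x. (\<forall>i\<in>{1..2*k}. 0 < x i) \<and> (\<Sum>i\<in>{1..2*k}. x i) < 1}" using False by simp
    ultimately show ?thesis
      unfolding simplex_integrand_def
      by (simp only: indicator_simps not_False_eq_True scaleR_zero_left scaleR_zero_right)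
  qed
  note cov = change_of_variables_integral[OF change_of_variables_cumulative[OF order_refl] L_integrand_measurable[OF k], of H]
  show "set_integrable ?M (open_simplex (2*k)) (L_integrand k j1 j2 H) \<longleftrightarrow> integrable ?M (simplex_integrand H)"
    unfolding set_integrable_def cov(1) by (rule Bochner_Integration.integrable_cong[OF refl eq])
  show "L_integral k j1 j2 H = (\<integral>x. simplex_integrand H x \<partial>?M)"
    unfolding L_integral_def set_lebesgue_integral_def cov(2)
    by (rule Bochner_Integration.integral_cong[OF refl eq])
qed

text \<open>With \<open>p\<close> the number of blocks inside \<open>S\<close>, solving
  \<open>|S| + (2H - 2) p = - l\<close> for \<open>H\<close> gives
  \<open>1 - (|S| + l) / (2p)\<close>. The case \<open>p = 0\<close> cannot occur, since then
  \<open>|S| + l\<close> would be 0. The runs of \<open>S\<close> provide \<open>C\<close>, with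
  total length \<open>|S|\<close> and denominator \<open>2p\<close>.\<close>

lemma exponent_nonpos_Int_in_progression:
  assumes S: "S \<subseteq> {1..2*k}" "S \<noteq> {}" and H: "exponent S H + 1 \<in> \<int>\<^sub>\<le>\<^sub>0"
  shows "\<exists>C. nonadjacent_collection k C \<and> denom k P C \<noteq> 0 \<and> H \<in> of_rat ` progression k P C"
proof -
  let ?p = "card (inside S)"
  obtain C where C: "nonadjacent_collection k C" "\<Union>C = S"
    using nonadjacent_collection_exists[OF S(1)] by blast
  have d: "denom k P C = 2 * int ?p" and c: "(\<Sum>I\<in>C. card I) = card S"
    using denom_nonadjacent_collection[OF C(1)] unfolding C(2) inside_def by blast+
  obtain l where l: "exponent S H + 1 = - of_nat l" using H by (auto elim: nonpos_Ints_cases')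
  have e: "of_nat (card S) - 2 * of_nat ?p + 2 * of_nat ?p * H = - of_nat l"
    using l unfolding exponent_def by (simp add: algebra_simps)
  have "finite S" using S finite_subset by blast
  then have cS: "0 < card S" using S by (simp add: card_gt_0_iff)
  have p: "?p \<noteq> 0"
  proof
    assume "?p = 0"
    with e have "complex_of_nat (card S + l) = 0" by simp
    then show False using cS by (simp only: of_nat_eq_0_iff)
  qed
  have "(1 - H) * (2 * of_nat ?p) = of_nat (card S + l)"
    using e unfolding of_nat_add by algebra
  then have "1 - H = of_nat (card S + l) / (2 * of_nat ?p)"
    using p by (subst nonzero_eq_divide_eq) simp_all
  then have "H = 1 - of_nat (card S + l) / (2 * of_nat ?p)" by algebra
  also have "\<dots> = of_rat (1 - of_nat ((\<Sum>I\<in>C. card I) + l) / of_int (denom k P C))"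
    by (simp add: of_rat_diff of_rat_divide of_rat_add of_rat_mult d c)
  finally have "H \<in> of_rat ` progression k P C" unfolding progression_def by blast
  then show ?thesis using C(1) d p by auto
qed

end

theorem corollary0p3:
  fixes k :: nat and P :: "nat set set" and j1 j2 :: "nat \<Rightarrow> nat"
  assumes "k \<ge> 1"
    and "pair_partition k P"
    and "P = (\<lambda>l. {j1 l, j2 l}) ` {1..k}"
  shows "(\<forall>H. Re H > 1/2 \<longrightarrow>
            set_integrable (lebesgue_power (2*k)) (open_simplex (2*k)) (L_integrand k j1 j2 H)) \<and>
         (\<exists>F :: complex \<Rightarrow> complex.
            F meromorphic_on UNIV \<and>
            (\<forall>H. Re H > 1/2 \<longrightarrow> F H = L_integral k j1 j2 H) \<and>
            F holomorphic_on
              - (\<Union>C \<in> {C. nonadjacent_collection k C \<and> denom k P C \<noteq> 0}.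
                   of_rat ` progression k P C))"
proof -
  interpret pair_blocks k P j1 j2 using assms(2,3) by unfold_locales
  have ne: "{1..2*k} \<noteq> {}" using assms(1) by simp
  obtain F where F: "F meromorphic_on UNIV"
    "\<forall>H. 1/2 < Re H \<longrightarrow> F H = (\<integral>x. simplex_integrand H x \<partial>lebesgue_power (2*k))"
    "F holomorphic_on {H. \<forall>S\<subseteq>{1..2*k}. S \<noteq> {} \<longrightarrow> exponent S H + 1 \<notin> \<int>\<^sub>\<le>\<^sub>0}"
    using simplex_integral_continuable(2)[OF ne] unfolding continuable_def by (elim exE conjE)
  have "F holomorphic_on - (\<Union>C \<in> {C. nonadjacent_collection k C \<and> denom k P C \<noteq> 0}.
      of_rat ` progression k P C)"
    by (rule holomorphic_on_subset[OF F(3)]) (use exponent_nonpos_Int_in_progression in blast)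
  then show ?thesis
    using F(1,2) simplex_integral_continuable(1)[OF ne] L_integral_eq_simplex_integral[OF assms(1)]
    by auto
qed

end
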